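(* Let $n,m$ be positive integers, and let $\mathbb D_{n,m}=\mathbb D_n\times\mathbb C^{(m,n)}$ be the Siegel-Jacobi disk with coordinates $(W,\eta)$. For any two positive real numbers $A$ and $B$, the following metric $d\tilde s^2_{n,m;A,B}$ defined by \begin{align*} d\tilde s^2_{n,m;A,B}=\;&4A\,\sigma\Big((I_n-W\overline W)^{-1}dW(I_n-\overline W W)^{-1}d\overline W\Big)\\ &+4B\,\bigg\{\sigma\Big((I_n-W\overline W)^{-1}\,{}^t(d\eta)\,d\overline\eta\Big)\\ &\quad+\sigma\Big((\eta\overline W-\overline\eta)(I_n-W\overline W)^{-1}dW(I_n-\overline W W)^{-1}\,{}^t(d\overline\eta)\Big)\\ &\quad+\sigma\Big((\overline\eta W-\eta)(I_n-\overline W W)^{-1}d\overline W(I_n-W\overline W)^{-1}\,{}^t(d\eta)\Big)\\ &\quad-\sigma\Big((I_n-W\overline W)^{-1}\,{}^t\eta\,\eta\,(I_n-\overline W W)^{-1}\overline W\,dW(I_n-\overline W W)^{-1}d\overline W\Big)\\ &\quad-\sigma\Big(W(I_n-\overline W W)^{-1}\,{}^t\overline\eta\,\overline\eta\,(I_n-W\overline W)^{-1}dW(I_n-\overline W W)^{-1}d\overline W\Big)\\ &\quad+\sigma\Big((I_n-W\overline W)^{-1}\,{}^t\eta\,\overline\eta\,(I_n-W\overline W)^{-1}dW(I_n-\overline W W)^{-1}d\overline W\Big)\\ &\quad+\sigma\Big((I_n-\overline W)^{-1}\,{}^t\overline\eta\,\eta\,\overline W(I_n-W\overline W)^{-1}dW(I_n-\overline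 W W)^{-1}d\overline W\Big)\\ &\quad+\sigma\Big((I_n-\overline W)^{-1}(I_n-W)(I_n-\overline W W)^{-1}\,{}^t\overline\eta\,\eta\,(I_n-\overline W W)^{-1}(I_n-\overline W)(I_n-W)^{-1}dW(I_n-\overline W W)^{-1}d\overline W\Big)\\ &\quad-\sigma\Big((I_n-W\overline W)^{-1}(I_n-W)(I_n-\overline W)^{-1}\,{}^t\overline\eta\,\eta\,(I_n-W)^{-1}dW(I_n-\overline W W)^{-1}d\overline W\Big)\bigg\} \end{align*} is a Riemannian metric on $\mathbb D_{n,m}$ which is invariant under the action $$\left(\begin{pmatrix}P&Q\\ \overline Q&\overline P\end{pmatrix},(\xi,\overline\xi;i\kappa)\right)\cdot(W,\eta)=\Big((PW+Q)(\overline Q W+\overline P)^{-1},\ (\eta+\xi W+\overline\xi)(\overline Q W+\overline P)^{-1}\Big)$$ of the Jacobi group $G^J_*$ on $\mathbb D_{n,m}$. If $n=m=1$ and $A=B=1$, this reads \begin{align*} \tfrac14\,d\tilde s^2_{1,1;1,1}=\;&\frac{dW\,d\overline W}{(1-|W|^2)^2}+\frac{1}{1-|W|^2}\,d\eta\,d\overline\eta+\frac{(1+|W|^2)|\eta|^2-\overline W\eta^2-W\overline\eta^2}{(1-|W|^2)^3}\,dW\,d\overline W\\ &+\frac{\eta\overline W-\overline\eta}{(1-|W|^2)^2}\,dW\,d\overline\eta+\frac{\overline\eta W-\eta}{(1-|W|^2)^2}\,d\overline W\,d\eta . \end{align*}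
   Context: Notation: $F^{(k,l)}$ is the set of $k\times l$ matrices with entries in $F$; ${}^tM$ is the transpose of $M$; $\overline M$ is the entrywise complex conjugate; $\sigma(M)$ is the trace of a square matrix $M$; $I_n$ is the identity matrix of degree $n$. Generalized unit disk: $\mathbb D_n=\{W\in\mathbb C^{(n,n)} : W={}^tW,\ I_n-\overline W W>0\}$ (positive definite Hermitian). Siegel-Jacobi disk: $\mathbb D_{n,m}=\mathbb D_n\times\mathbb C^{(m,n)}$, with coordinates $(W,\eta)$, $W=(w_{\mu\nu})\in\mathbb D_n$, $\eta=(\eta_{kl})\in\mathbb C^{(m,n)}$. Put $dW=(dw_{\mu\nu})$, $d\overline W=(d\overline w_{\mu\nu})$, $d\eta=(d\eta_{kl})$, $d\overline\eta=(d\overline\eta_{kl})$ (matrices of one-forms). In expressions for metrics, products of one-forms are symmetric (commutative) products, so that each expression is a quadratic form on real tangent vectors. Groups: $G_*=SU(n,n)\cap Sp(n,\mathbb C)$, whose elements are written as $\begin{pmatrix}P&Q\\ \overline Q&\overline P\end{pmatrix}$ with $P,Q\in\mathbb C^{(n,n)}$; here $Sp(n,\mathbb C)$ is the group of complex $2n\times 2n$ matrices $M$ with ${}^tMJ_nM=J_n$, $J_n=\begin{pmatrix}0&I_n\\-I_n&0\end{pmatrix}$, and $SU(n,n)$ is defined with respect to the Hermitian form with matrix $\mathrm{diag}(I_n,-I_n)$. The Jacobi group is $$G^J_*=\left\{\left(\begin{pmatrix}P&Q\\ \overline Q&\overline P\end{pmatrix},(\xi,\overline\xi;i\kappa)\right)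 : \begin{pmatrix}P&Q\\ \overline Q&\overline P\end{pmatrix}\in G_*,\ \xi\in\mathbb C^{(m,n)},\ \kappa\in\mathbb R^{(m,m)}\right\}$$ with multiplication $$\left(g,(\xi,\overline\xi;i\kappa)\right)\cdot\left(g',(\xi',\overline{\xi'};i\kappa')\right)=\left(gg',\ (\tilde\xi+\xi',\ \tilde{\overline\xi}+\overline{\xi'};\ i\kappa+i\kappa'+\tilde\xi\,{}^t\overline{\xi'}-\tilde{\overline\xi}\,{}^t\xi')\right),$$ where $g'=\begin{pmatrix}P'&Q'\\ \overline{Q'}&\overline{P'}\end{pmatrix}$, $\tilde\xi=\xi P'+\overline\xi\,\overline{Q'}$ and $\tilde{\overline\xi}=\xi Q'+\overline\xi\,\overline{P'}$. *)

theory Defs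
  imports "HOL-Analysis.Analysis" "HOL-Algebra.Group"
begin

section \<open>Riemannian metrics on a relatively open subset of a subspace\<close>

text \<open>
  A manifold is given here as a relatively open subset \<open>D\<close> of a real linear subspace \<open>E\<close> of a
  Euclidean space, so that the tangent space at every point of \<open>D\<close> is \<open>E\<close>. Since \<open>D\<close> is
  open in \<open>E\<close>, derivatives taken within \<open>D\<close> are uniquely determined on \<open>E\<close>; their values
  outside \<open>E\<close> carry no information and are never used.
\<close>

primrec Ck_on :: "nat \<Rightarrow> 'a::euclidean_space set \<Rightarrow> 'a set \<Rightarrow> ('a \<Rightarrow> real) \<Rightarrow> bool" where
  "Ck_on 0 E D f = continuous_on D f"
| "Ck_on (Suc k) E D f =
     (\<exists>f'. (\<forall>p\<in>D. (f has_derivative f' p) (at p within D)) \<and>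
           (\<forall>v\<in>E. Ck_on k E D (\<lambda>p. f' p v)))"

definition smooth_on :: "'a::euclidean_space set \<Rightarrow> 'a set \<Rightarrow> ('a \<Rightarrow> real) \<Rightarrow> bool" where
  "smooth_on E D f \<longleftrightarrow> (\<forall>k. Ck_on k E D f)"

definition riemannian_metric_on ::
    "'a::euclidean_space set \<Rightarrow> 'a set \<Rightarrow> ('a \<Rightarrow> 'a \<Rightarrow> 'a \<Rightarrow> real) \<Rightarrow> bool" where
  "riemannian_metric_on E D g \<longleftrightarrow>
     subspace E \<and> openin (top_of_set E) D \<and>
     (\<forall>p\<in>D. \<forall>u\<in>E. \<forall>v\<in>E. g p u v = g p v u) \<and>
     (\<forall>p\<in>D. \<forall>u\<in>E. \<forall>v\<in>E. \<forall>w\<in>E. \<forall>a b.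
        g p (a *\<^sub>R u + b *\<^sub>R v) w = a * g p u w + b * g p v w) \<and>
     (\<forall>p\<in>D. \<forall>v\<in>E. v \<noteq> 0 \<longrightarrow> g p v v > 0) \<and>
     (\<forall>u\<in>E. \<forall>v\<in>E. smooth_on E D (\<lambda>p. g p u v))"

text \<open>\<open>f\<close> maps \<open>D\<close> to itself and the pullback of \<open>g\<close> along \<open>f\<close> is \<open>g\<close>.\<close>

definition preserves_metric_on ::
    "'a::euclidean_space set \<Rightarrow> 'a set \<Rightarrow> ('a \<Rightarrow> 'a \<Rightarrow> 'a \<Rightarrow> real) \<Rightarrow> ('a \<Rightarrow> 'a) \<Rightarrow> bool" where
  "preserves_metric_on E D g f \<longleftrightarrow>
     (\<forall>p\<in>D. f p \<in> D \<and>
        (\<exists>f'. (f has_derivative f') (at p within D) \<and> f' ` E \<subseteq> E \<and>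
              (\<forall>u\<in>E. \<forall>v\<in>E. g (f p) (f' u) (f' v) = g p u v)))"

section \<open>The Siegel-Jacobi disk\<close>

text \<open>
  A \<open>k\<times>l\<close> matrix over \<open>F\<close> has type \<^typ>\<open>'f^'l^'k\<close>: the column index comes first.
\<close>

definition cnj_mat :: "complex^'l^'k \<Rightarrow> complex^'l^'k" where
  "cnj_mat M = (\<chi> i j. cnj (M $ i $ j))"

text \<open>\<open>Re\<close> only changes the type below: the quadratic form of a Hermitian matrix is real.\<close>

definition pos_def_hermitian :: "complex^'n^'n \<Rightarrow> bool" where
  "pos_def_hermitian H \<longleftrightarrow>
     transpose (cnj_mat H) = H \<and>
     (\<forall>z. z \<noteq> 0 \<longrightarrow> Re (\<Sum>i\<in>UNIV. cnj (z $ i) * (H *v z) $ i) > 0)"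

definition unit_disk :: "(complex^'n^'n) set" where
  "unit_disk = {W. transpose W = W \<and> pos_def_hermitian (mat 1 - cnj_mat W ** W)}"

definition sj_disk :: "((complex^'n^'n) \<times> (complex^'n^'m)) set" where
  "sj_disk = unit_disk \<times> UNIV"

definition sj_tangent :: "((complex^'n^'n) \<times> (complex^'n^'m)) set" where
  "sj_tangent = {dW. transpose dW = dW} \<times> UNIV"

text \<open>
  The value of the quadratic form on the tangent vector \<open>(dW, d\<eta>)\<close> at \<open>(W, \<eta>)\<close>; the
  conjugate one-forms take the values \<open>cnj_mat dW\<close> and \<open>cnj_mat d\<eta>\<close>. It is complex by
  construction.
\<close>

definition sj_ds2 :: "real \<Rightarrow> real \<Rightarrow> (complex^'n^'n) \<times> (complex^'n^'m) \<Rightarrow>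
    (complex^'n^'n) \<times> (complex^'n^'m) \<Rightarrow> complex" where
  "sj_ds2 A B = (\<lambda>(W, \<eta>) (dW, d\<eta>).
     let Wc = cnj_mat W; \<eta>c = cnj_mat \<eta>; dWc = cnj_mat dW; d\<eta>c = cnj_mat d\<eta>;
         I = (mat 1 :: complex^'n^'n);
         R = matrix_inv (I - W ** Wc);
         S = matrix_inv (I - Wc ** W)
     in 4 * of_real A * trace (R ** dW ** S ** dWc)
      + 4 * of_real B *
        ( trace (R ** transpose d\<eta> ** d\<eta>c)
        + trace ((\<eta> ** Wc - \<eta>c) ** R ** dW ** S ** transpose d\<eta>c)
        + trace ((\<eta>c ** W - \<eta>) ** S ** dWc ** R ** transpose d\<eta>)
        - trace (R ** transpose \<eta> ** \<eta> ** S ** Wc ** dW ** S ** dWc)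
        - trace (W ** S ** transpose \<eta>c ** \<eta>c ** R ** dW ** S ** dWc)
        + trace (R ** transpose \<eta> ** \<eta>c ** R ** dW ** S ** dWc)
        + trace (matrix_inv (I - Wc) ** transpose \<eta>c ** \<eta> ** Wc ** R ** dW ** S ** dWc)
        + trace (matrix_inv (I - Wc) ** (I - W) ** S ** transpose \<eta>c ** \<eta> ** S **
                 (I - Wc) ** matrix_inv (I - W) ** dW ** S ** dWc)
        - trace (R ** (I - W) ** matrix_inv (I - Wc) ** transpose \<eta>c ** \<eta> **
                 matrix_inv (I - W) ** dW ** S ** dWc)))"

section \<open>The Jacobi group and its action\<close>

definition block_mat ::
    "complex^'n^'n \<Rightarrow> complex^'n^'n \<Rightarrow> complex^'n^'n \<Rightarrow> complex^'n^'n \<Rightarrow> complex^('n + 'n)^('n + 'n)"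
  where
  "block_mat P Q R S = (\<chi> i j.
     case i of
       Inl a \<Rightarrow> (case j of Inl b \<Rightarrow> P $ a $ b | Inr b \<Rightarrow> Q $ a $ b)
     | Inr a \<Rightarrow> (case j of Inl b \<Rightarrow> R $ a $ b | Inr b \<Rightarrow> S $ a $ b))"

definition block11 :: "complex^('n + 'n)^('n + 'n) \<Rightarrow> complex^'n^'n" where
  "block11 M = (\<chi> a b. M $ Inl a $ Inl b)"

definition block12 :: "complex^('n + 'n)^('n + 'n) \<Rightarrow> complex^'n^'n" where
  "block12 M = (\<chi> a b. M $ Inl a $ Inr b)"

definition Sp_group :: "(complex^('n::finite + 'n)^('n + 'n)) set" where
  "Sp_group = {M. let J = block_mat 0 (mat 1) (- mat 1) 0 in transpose M ** J ** M = J}"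

definition SU_group :: "(complex^('n::finite + 'n)^('n + 'n)) set" where
  "SU_group = {M. (let K = block_mat (mat 1) 0 0 (- mat 1) in
                     transpose (cnj_mat M) ** K ** M = K) \<and> det M = 1}"

definition G_star :: "(complex^('n::finite + 'n)^('n + 'n)) set" where
  "G_star = SU_group \<inter> Sp_group"

text \<open>
  An element \<open>(g, (\<xi>, cnj \<xi>; i\<kappa>))\<close> is the nested tuple \<open>(g, \<xi>, cnj_mat \<xi>, i_mat \<kappa>)\<close>.
\<close>

type_synonym ('n, 'm) jacobi =
  "(complex^('n + 'n)^('n + 'n)) \<times> (complex^'n^'m) \<times> (complex^'n^'m) \<times> (complex^'m^'m)"

definition i_mat :: "real^'m^'m \<Rightarrow> complex^'m^'m" where
  "i_mat \<kappa> = (\<chi> k l. \<i> * complex_of_real (\<kappa> $ k $ l))"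

definition jacobi_mult ::
    "('n::finite, 'm::finite) jacobi \<Rightarrow> ('n, 'm) jacobi \<Rightarrow> ('n, 'm) jacobi" where
  "jacobi_mult = (\<lambda>(g, \<xi>, \<xi>c, k) (g', \<xi>', \<xi>c', k').
     let P' = block11 g'; Q' = block12 g';
         t = \<xi> ** P' + \<xi>c ** cnj_mat Q';
         tc = \<xi> ** Q' + \<xi>c ** cnj_mat P'
     in (g ** g', t + \<xi>', tc + \<xi>c', k + k' + t ** transpose \<xi>c' - tc ** transpose \<xi>'))"

definition jacobi_group :: "('n::finite, 'm::finite) jacobi monoid" where
  "jacobi_group =
     \<lparr>carrier = {(block_mat P Q (cnj_mat Q) (cnj_mat P), \<xi>, cnj_mat \<xi>, i_mat \<kappa>) | P Q \<xi> \<kappa>.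
                   block_mat P Q (cnj_mat Q) (cnj_mat P) \<in> G_star},
      monoid.mult = jacobi_mult,
      one = (mat 1, 0, 0, 0)\<rparr>"

definition jacobi_act :: "('n::finite, 'm::finite) jacobi \<Rightarrow>
    (complex^'n^'n) \<times> (complex^'n^'m) \<Rightarrow> (complex^'n^'n) \<times> (complex^'n^'m)" where
  "jacobi_act = (\<lambda>(g, \<xi>, \<xi>c, k) (W, \<eta>).
     let P = block11 g; Q = block12 g;
         N = matrix_inv (cnj_mat Q ** W + cnj_mat P)
     in ((P ** W + Q) ** N, (\<eta> + \<xi> ** W + \<xi>c) ** N))"

end

theory Submission
  imports Defs
begin

text \<open>
  With \<open>R = (I - W W\<^sup>c)\<^sup>-\<^sup>1\<close>, \<open>S = (I - W\<^sup>c W)\<^sup>-\<^sup>1\<close> (where \<open>c\<close> is complex conjugation and \<open>*\<close> the conjugate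
  transpose) and \<open>\<theta> = d\<eta> + (\<eta> W\<^sup>c - \<eta>\<^sup>c) R dW\<close>, the quadratic form collapses to
  \<open>4 A tr(R dW S dW\<^sup>c) + 4 B tr(\<theta> S \<theta>\<^sup>*)\<close>: the last three of its terms add up to the single
  missing term of the expansion of \<open>\<theta> S \<theta>\<^sup>*\<close>. This form is positive because \<open>R\<close> and \<open>S\<close> are.
  If \<open>M = Q\<^sup>c W + P\<^sup>c\<close> is the automorphy factor of a group element and \<open>N = M\<^sup>-\<^sup>1\<close>, then along its action
  \<open>dW\<close>, \<open>S\<close> and \<open>\<theta>\<close> become \<open>N\<^sup>T dW N\<close>, \<open>M S M\<^sup>*\<close> and \<open>\<theta> N\<close>, so both traces are invariant.
\<close>

section \<open>Complex matrices and positivity\<close>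

text \<open>A metric is bilinear while the given expression is only a quadratic form, so that form
  is first polarized to a sesquilinear one; Hermitian symmetry then yields both the symmetry of its
  real part and the reality of the quadratic form. Three terms contain inverses of I - W or of its
  conjugate: these exist because points of the disk are strict contractions, and they disappear only
  when the three terms are added. The trace in dW carries two different matrices \<open>R\<close>
  and \<open>S\<close>, so it is not visibly a sum of values of one positive form; expanding
  \<open>R\<close> as I + \<open>W ** S ** Wc\<close> leaves such a sum plus the trace of a product
  of two semidefinite matrices. For invariance, a group element sends the block column (W, I) to
  (\<open>L\<close>, \<open>M\<close>) with \<open>L = P ** W + Q\<close>. Preservation of the
  Hermitian form on that column is the one identity behind the invertibility of \<open>M\<close>,
  the contraction property of the image point and the transformation of \<open>S\<close>.\<close>

lemma cnj_mat_nth [simp]: "cnj_mat M $ i $ j = cnj (M $ i $ j)"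
  by (simp add: cnj_mat_def)

lemma cnj_mat_cnj_mat [simp]: "cnj_mat (cnj_mat M) = M"
  by (simp add: vec_eq_iff)

lemma cnj_mat_mult: "cnj_mat (A ** B) = cnj_mat A ** cnj_mat B"
  by (simp add: vec_eq_iff matrix_matrix_mult_def)

lemma cnj_mat_add: "cnj_mat (A + B) = cnj_mat A + cnj_mat B"
  by (simp add: vec_eq_iff)

lemma cnj_mat_diff: "cnj_mat (A - B) = cnj_mat A - cnj_mat B"
  by (simp add: vec_eq_iff)

lemma cnj_mat_1 [simp]: "cnj_mat (mat 1) = mat 1"
  by (simp add: vec_eq_iff mat_def)

lemma cnj_mat_transpose: "cnj_mat (transpose A) = transpose (cnj_mat A)"
  by (simp add: vec_eq_iff transpose_def)

lemma cnj_mat_inv_eq: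
  fixes A :: "complex^'n^'n"
  assumes "A ** B = mat 1"
  shows "cnj_mat A ** cnj_mat B = mat 1"
  using assms by (metis cnj_mat_mult cnj_mat_1)

lemma transpose_add: "transpose (A + B) = transpose A + transpose B"
  by (simp add: vec_eq_iff transpose_def)

lemma transpose_diff: "transpose (A - B) = transpose A - transpose B"
  by (simp add: vec_eq_iff transpose_def)

lemma transpose_nth [simp]: "transpose A $ i $ j = A $ j $ i"
  by (simp add: transpose_def)

lemma trace_transpose: "trace (transpose A) = trace A"
  by (simp add: trace_def)

lemma trace_cnj_mat: "trace (cnj_mat A) = cnj (trace A)"
  by (simp add: trace_def)

section \<open>Hermitian forms, semidefinite matrices and traces\<close>

definition herm :: "complex^'n \<Rightarrow> complex^'n \<Rightarrow> complex" where
  "herm x y = (\<Sum>i\<in>UNIV. cnj (x $ i) * y $ i)"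

definition psd_hermitian :: "complex^'n^'n \<Rightarrow> bool" where
  "psd_hermitian H \<longleftrightarrow> transpose (cnj_mat H) = H \<and> (\<forall>z. Re (herm z (H *v z)) \<ge> 0)"

lemma herm_add_left: "herm (x + y) z = herm x z + herm y z"
  by (simp add: herm_def algebra_simps sum.distrib)

lemma herm_add_right: "herm x (y + z) = herm x y + herm x z"
  by (simp add: herm_def algebra_simps sum.distrib)

lemma herm_diff_right: "herm x (y - z) = herm x y - herm x z"
  by (simp add: herm_def algebra_simps sum_subtractf)

lemma herm_axis_left [simp]: "herm (axis i a) y = cnj a * y $ i"
  by (simp add: herm_def axis_def if_distrib if_distribR cong: if_cong)

lemma cnj_herm: "cnj (herm x y) = herm y x"
  by (simp add: herm_def mult.commute)

lemma herm_matrix: "herm x (A *v y) = herm (transpose (cnj_mat A) *v x) y"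
proof -
  have "herm x (A *v y) = (\<Sum>i\<in>UNIV. \<Sum>j\<in>UNIV. cnj (x $ i) * (A $ i $ j * y $ j))"
    by (simp add: herm_def matrix_vector_mult_def sum_distrib_left)
  also have "\<dots> = (\<Sum>j\<in>UNIV. \<Sum>i\<in>UNIV. cnj (x $ i) * (A $ i $ j * y $ j))"
    by (rule sum.swap)
  also have "\<dots> = herm (\<chi> j. \<Sum>i\<in>UNIV. cnj (A $ i $ j) * x $ i) y"
    unfolding herm_def sum_distrib_right vec_lambda_beta cnj_sum
    by (simp add: mult_ac)
  also have "(\<chi> j. \<Sum>i\<in>UNIV. cnj (A $ i $ j) * x $ i) = transpose (cnj_mat A) *v x"
    by (simp add: matrix_vector_mult_def vec_eq_iff del: transpose_matrix_vector)
  finally show ?thesis .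
qed

lemma herm_self: "herm z z = complex_of_real ((norm z)\<^sup>2)"
proof -
  have "cnj (z $ i) * z $ i = complex_of_real ((cmod (z $ i))\<^sup>2)" for i
    by (metis complex_norm_square mult.commute of_real_power)
  then show ?thesis
    by (simp add: herm_def norm_vec_def L2_set_def real_sqrt_pow2 sum_nonneg)
qed

lemma pos_def_hermitian_alt:
  "pos_def_hermitian H \<longleftrightarrow> transpose (cnj_mat H) = H \<and> (\<forall>z. z \<noteq> 0 \<longrightarrow> Re (herm z (H *v z)) > 0)"
  by (simp add: pos_def_hermitian_def herm_def)

lemma pos_def_imp_psd: "pos_def_hermitian H \<Longrightarrow> psd_hermitian H"
  unfolding pos_def_hermitian_alt psd_hermitian_def
  by (metis herm_matrix less_eq_real_def matrix_vector_mult_0_right herm_self norm_zero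
      zero_power2 of_real_0 zero_complex.simps(1) order_refl)

text \<open>Substituting \<open>T *v z\<close> into the form of \<open>H\<close> gives the form of
  the congruent matrix.\<close>

lemma psd_congruence:
  assumes "psd_hermitian H"
  shows "psd_hermitian (transpose (cnj_mat T) ** H ** T)"
proof -
  have "transpose (cnj_mat (transpose (cnj_mat T) ** H ** T)) = transpose (cnj_mat T) ** H ** T"
    using assms by (simp add: psd_hermitian_def cnj_mat_mult cnj_mat_transpose matrix_transpose_mul
        matrix_mul_assoc)
  moreover have "herm z ((transpose (cnj_mat T) ** H ** T) *v z) = herm (T *v z) (H *v (T *v z))" for z
    by (simp add: matrix_vector_mul_assoc[symmetric] herm_matrix[of z] cnj_mat_transpose
        del: transpose_matrix_vector)
  ultimately show ?thesis using assms by (simp add: psd_hermitian_def)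
qed

lemma hermitian_nth:
  assumes "transpose (cnj_mat N) = N"
  shows "N $ i $ j = cnj (N $ j $ i)"
  using assms by (metis cnj_mat_nth transpose_nth)

lemma matrix_vector_axis: "(N *v axis j b) $ k = N $ k $ j * b" for N :: "'a::comm_semiring_1^'n^'m"
  by (simp add: matrix_vector_mult_def axis_def if_distrib if_distribR cong: if_cong)

lemma psd_diag_nonneg:
  assumes "psd_hermitian N"
  shows "N $ i $ i = complex_of_real (Re (N $ i $ i))" and "Re (N $ i $ i) \<ge> 0"
proof -
  have "N $ i $ i = cnj (N $ i $ i)" using assms hermitian_nth psd_hermitian_def by blast
  then show "N $ i $ i = complex_of_real (Re (N $ i $ i))"
    by (metis Reals_cnj_iff of_real_Re)
  have "Re (herm (axis i 1) (N *v axis i 1)) \<ge> 0" using assms psd_hermitian_def by blast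
  then show "Re (N $ i $ i) \<ge> 0" by (simp add: matrix_vector_axis)
qed

text \<open>Without the diagonal entry the form is affine along the direction \<open>axis i\<close>,
  so a nonzero entry \<open>N $ i $ j\<close> would drive it below zero.\<close>

lemma psd_diag_zero:
  assumes "psd_hermitian N" and "N $ i $ i = 0"
  shows "N $ i $ j = 0"
proof (rule ccontr)
  assume n0: "N $ i $ j \<noteq> 0"
  define c where "c = (cmod (N $ i $ j))\<^sup>2"
  have c: "c > 0" using n0 by (simp add: c_def)
  have mm: "N $ i $ j * cnj (N $ i $ j) = complex_of_real c"
    by (simp add: c_def complex_norm_square[symmetric])
  have ji: "N $ j $ i = cnj (N $ i $ j)"
    using assms(1) hermitian_nth psd_hermitian_def by blast
  \<comment> \<open>The form at \<open>z\<close> below is \<open>Re (N $ j $ j) - 2 * s * c\<close>;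
    this \<open>s\<close> makes it \<open>- Re (N $ j $ j) - 2\<close>.\<close>
  define s where "s = (Re (N $ j $ j) + 1) / c"
  define z where "z = axis i (- complex_of_real s * N $ i $ j) + axis j 1"
  have "herm z (N *v z) = - (2 * complex_of_real s) * (N $ i $ j * cnj (N $ i $ j)) + N $ j $ j"
    by (simp add: z_def matrix_vector_right_distrib herm_add_left matrix_vector_axis ji assms(2)
        algebra_simps)
  then have "Re (herm z (N *v z)) = - (2 * s * c) + Re (N $ j $ j)"
    unfolding mm by simp
  also have "\<dots> < 0"
    using c psd_diag_nonneg(2)[OF assms(1), of j] by (simp add: s_def)
  finally show False using assms(1) by (simp add: psd_hermitian_def not_le[symmetric])
qed

text \<open>For \<open>a = b\<close> the trace against a rank-one matrix is a value of the form of
  \<open>R\<close>, which gives the sign of each split-off summand.\<close>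

lemma trace_outer: "trace ((\<chi> j k. a $ j * cnj (b $ k)) ** R) = herm b (R *v a)"
proof -
  have "trace ((\<chi> j k. a $ j * cnj (b $ k)) ** R) = (\<Sum>j\<in>UNIV. \<Sum>k\<in>UNIV. a $ j * cnj (b $ k) * R $ k $ j)"
    by (simp add: trace_def matrix_matrix_mult_def)
  also have "\<dots> = (\<Sum>k\<in>UNIV. \<Sum>j\<in>UNIV. a $ j * cnj (b $ k) * R $ k $ j)" by (rule sum.swap)
  also have "\<dots> = herm b (R *v a)"
    by (simp add: herm_def matrix_vector_mult_def sum_distrib_left mult_ac)
  finally show ?thesis .
qed

text \<open>Outer-product (Cholesky) elimination: each step splits off a rank-one matrix and clears one
  diagonal entry.\<close>

lemma trace_psd_mult_nonneg:
  fixes N R :: "complex^'n^'n"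
  assumes "psd_hermitian N" and "psd_hermitian R"
  shows "Re (trace (N ** R)) \<ge> 0"
  using assms(1)
\<comment> \<open>The count of nonzero diagonal entries is a suitable measure because a semidefinite
  matrix with zero diagonal vanishes.\<close>
proof (induction "card {i. N $ i $ i \<noteq> 0}" arbitrary: N rule: less_induct)
  case less
  show ?case
  proof (cases "\<exists>i. N $ i $ i \<noteq> 0")
    case False
    then have "N = 0" using psd_diag_zero[OF less.prems] by (simp add: vec_eq_iff)
    then show ?thesis by (simp add: trace_def matrix_matrix_mult_def)
  next
    case True
    then obtain i where i: "N $ i $ i \<noteq> 0" by blast
    define d where "d = Re (N $ i $ i)"
    have Nd: "N $ i $ i = complex_of_real d" and d: "d > 0"
      using psd_diag_nonneg[OF less.prems, of i] i unfolding d_def by (auto simp: less_le)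
    have hN: "N $ j $ k = cnj (N $ k $ j)" for j k
      using less.prems hermitian_nth psd_hermitian_def by blast
    define v where "v = (\<chi> j. N $ j $ i)"
    define V where "V = (\<chi> j k. v $ j * cnj (v $ k))"
    \<comment> \<open>The rank-one matrix \<open>(1 / d) *\<^sub>R V\<close> has the same column
      \<open>i\<close> as \<open>N\<close>, so \<open>N'\<close> is the Schur complement of the
      pivot \<open>d\<close>, bordered by zeros.\<close>
    define N' where "N' = N - (1 / d) *\<^sub>R V"
    have Vz: "V *v z = herm v z *s v" for z
      by (simp add: V_def vec_eq_iff matrix_vector_mult_def herm_def sum_distrib_left mult_ac)
    have N'z: "N' *v z = N *v z - (1 / d) *\<^sub>R (V *v z)" for z
      by (simp add: N'_def vec_eq_iff matrix_vector_mult_def algebra_simps sum_subtractf scaleR_sum_right)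
    have psd': "psd_hermitian N'"
      unfolding psd_hermitian_def
    proof (intro conjI allI)
      have "cnj (N' $ k $ j) = N' $ j $ k" for j k
        using hN[of k j] by (simp add: N'_def V_def mult.commute)
      then show "transpose (cnj_mat N') = N'"
        by (simp add: vec_eq_iff)
      fix z
      define c where "c = (N *v z) $ i"
      have vz: "herm v z = c"
        unfolding c_def v_def herm_def matrix_vector_mult_def by (simp add: hN[symmetric])
      \<comment> \<open>This \<open>t\<close> minimizes the form of \<open>N\<close> along
        \<open>z + axis i t\<close>; the minimum is the form of \<open>N'\<close> at
        \<open>z\<close>, which is therefore nonnegative.\<close>
      define t where "t = - (c / complex_of_real d)"
      have Nv: "N *v axis i t = t *s v"
        by (simp add: vec_eq_iff matrix_vector_axis v_def mult.commute)
      have zv: "herm z (a *s v) = a * cnj c" for a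
        by (simp add: vz[symmetric] cnj_herm) (simp add: herm_def sum_distrib_left mult_ac)
      have vi: "v $ i = complex_of_real d" by (simp add: v_def Nd)
      have "herm (z + axis i t) (N *v (z + axis i t))
        = herm z (N *v z) + t * cnj c + cnj t * c + cnj t * t * complex_of_real d"
        by (simp add: matrix_vector_right_distrib herm_add_left herm_add_right Nv zv vi
            c_def[symmetric] algebra_simps)
      also have "\<dots> = herm z (N *v z) - c * cnj c / complex_of_real d"
        using d by (simp add: t_def field_simps)
      also have "\<dots> = herm z (N' *v z)"
      proof -
        have "herm z ((1 / d) *\<^sub>R (c *s v)) = (1 / d) *\<^sub>R herm z (c *s v)"
          by (simp add: herm_def scaleR_sum_right)
        then show ?thesis
          by (simp add: N'z Vz herm_diff_right vz zv scaleR_conv_of_real)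
      qed
      finally show "0 \<le> Re (herm z (N' *v z))"
        using less.prems unfolding psd_hermitian_def by metis
    qed
    have "N' $ i $ i = N $ i $ i - (1 / d) *\<^sub>R V $ i $ i"
      by (simp add: N'_def)
    then have "N' $ i $ i = 0"
      using d by (simp add: V_def v_def Nd scaleR_complex.ctr complex_eq_iff)
    \<comment> \<open>Diagonal entries that are already zero stay zero: their row in
      \<open>N\<close> vanishes, so \<open>V\<close> contributes nothing there.\<close>
    moreover have "N' $ j $ j = 0" if "N $ j $ j = 0" for j
      using psd_diag_zero[OF less.prems that, of i] that by (simp add: N'_def V_def v_def)
    ultimately have "{j. N' $ j $ j \<noteq> 0} \<subset> {j. N $ j $ j \<noteq> 0}"
      using i by auto
    then have "Re (trace (N' ** R)) \<ge> 0"
      by (intro less.hyps psd' psubset_card_mono finite)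
    moreover have "N ** R = N' ** R + (1 / d) *\<^sub>R (V ** R)"
      by (simp add: N'_def vec_eq_iff matrix_matrix_mult_def algebra_simps sum_subtractf scaleR_sum_right)
    then have "trace (N ** R) = trace (N' ** R) + (1 / d) *\<^sub>R trace (V ** R)"
      by (simp add: trace_add) (simp add: trace_def scaleR_sum_right)
    moreover have "Re (trace (V ** R)) \<ge> 0"
      using assms(2) unfolding V_def trace_outer psd_hermitian_def by blast
    ultimately show ?thesis using d by simp
  qed
qed

text \<open>Each diagonal entry is the form of \<open>S\<close> at a conjugated row of
  \<open>Y\<close>, which reduces both sign statements below to single rows.\<close>

lemma trace_congruence:
  fixes Y :: "complex^'n^'k"
  shows "trace (Y ** S ** transpose (cnj_mat Y)) = (\<Sum>i\<in>UNIV. herm (\<chi> j. cnj (Y $ i $ j)) (S *v (\<chi> j. cnj (Y $ i $ j))))"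
proof -
  have "(Y ** S ** transpose (cnj_mat Y)) $ i $ i = herm (\<chi> j. cnj (Y $ i $ j)) (S *v (\<chi> j. cnj (Y $ i $ j)))" for i
    unfolding matrix_mul_assoc[symmetric]
    by (simp only: matrix_matrix_mult_def herm_def matrix_vector_mult_def vec_lambda_beta
        transpose_nth cnj_mat_nth complex_cnj_cnj)
  then show ?thesis by (simp add: trace_def)
qed

lemma trace_congruence_nonneg:
  fixes Y :: "complex^'n^'k"
  assumes "psd_hermitian S"
  shows "Re (trace (Y ** S ** transpose (cnj_mat Y))) \<ge> 0"
  using assms unfolding trace_congruence Re_sum psd_hermitian_def by (intro sum_nonneg) blast

lemma trace_congruence_pos:
  fixes Y :: "complex^'n^'k"
  assumes S: "pos_def_hermitian S" and "Y \<noteq> 0"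
  shows "Re (trace (Y ** S ** transpose (cnj_mat Y))) > 0"
proof -
  from \<open>Y \<noteq> 0\<close> obtain i where i: "(\<chi> j. cnj (Y $ i $ j)) \<noteq> 0"
    by (auto simp: vec_eq_iff)
  show ?thesis unfolding trace_congruence Re_sum
  proof (rule sum_pos2[of _ i])
    show "0 < Re (herm (\<chi> j. cnj (Y $ i $ j)) (S *v (\<chi> j. cnj (Y $ i $ j))))"
      using S i unfolding pos_def_hermitian_alt by blast
    show "0 \<le> Re (herm (\<chi> j. cnj (Y $ k $ j)) (S *v (\<chi> j. cnj (Y $ k $ j))))" for k
      using pos_def_imp_psd[OF S] unfolding psd_hermitian_def by blast
  qed auto
qed

section \<open>Distributivity and matrix inverses\<close>

lemma matrix_add_rdistrib: "(A + B) ** C = A ** C + B ** (C :: 'a::semiring_1^'k^'n)"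
  by (vector matrix_matrix_mult_def sum.distrib distrib_right)

lemma matrix_diff_ldistrib: "A ** (B - C) = A ** B - A ** (C :: 'a::ring_1^'k^'n)"
  by (vector matrix_matrix_mult_def sum_subtractf right_diff_distrib)

lemma matrix_diff_rdistrib: "(A - B) ** C = A ** C - B ** (C :: 'a::ring_1^'k^'n)"
  by (vector matrix_matrix_mult_def sum_subtractf left_diff_distrib)

lemmas matrix_distribs = matrix_add_ldistrib matrix_add_rdistrib matrix_diff_ldistrib
  matrix_diff_rdistrib

lemma matrix_inv_right:
  fixes A :: "'a::semiring_1^'n^'m"
  assumes "invertible A"
  shows "A ** matrix_inv A = mat 1"
  using someI_ex[OF assms[unfolded invertible_def]] by (simp add: matrix_inv_def)

lemma matrix_inv_left:
  fixes A :: "'a::semiring_1^'n^'m"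
  assumes "invertible A"
  shows "matrix_inv A ** A = mat 1"
  using someI_ex[OF assms[unfolded invertible_def]] by (simp add: matrix_inv_def)

text \<open>\<open>matrix_inv\<close> is a choice among two-sided inverses; for square matrices over
  a field a right inverse already pins it down.\<close>

lemma matrix_inv_unique:
  fixes A B :: "'a::field^'n^'n"
  assumes "A ** B = mat 1"
  shows "matrix_inv A = B"
proof -
  have "invertible A" using assms invertible_right_inverse by blast
  then show ?thesis
    using assms by (metis matrix_inv_left matrix_mul_assoc matrix_mul_lid matrix_mul_rid)
qed

lemma invertible_cnj_mat: "invertible A \<Longrightarrow> invertible (cnj_mat A)" for A :: "complex^'n^'n"
  by (metis cnj_mat_inv_eq invertible_right_inverse)

lemma matrix_inv_cnj_mat: "invertible A \<Longrightarrow> matrix_inv (cnj_mat A) = cnj_mat (matrix_inv A)"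
  for A :: "complex^'n^'n"
  by (metis cnj_mat_inv_eq matrix_inv_right matrix_inv_unique)

lemma matrix_inv_transpose: "invertible A \<Longrightarrow> matrix_inv (transpose A) = transpose (matrix_inv A)"
  for A :: "complex^'n^'n"
  by (metis matrix_inv_left matrix_inv_unique matrix_transpose_mul transpose_mat)

lemma invertible_ker: "(\<And>z. A *v z = 0 \<Longrightarrow> z = 0) \<Longrightarrow> invertible A" for A :: "complex^'n^'n"
  using matrix_left_invertible_ker invertible_left_inverse by blast

lemma pos_def_imp_invertible:
  assumes "pos_def_hermitian H"
  shows "invertible H"
proof (rule invertible_ker, rule ccontr)
  fix z assume "H *v z = 0" "z \<noteq> 0"
  then show False using assms unfolding pos_def_hermitian_alt by (metis herm_diff_right diff_self less_irrefl zero_complex.simps(1))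
qed

lemma pos_def_matrix_inv:
  assumes "pos_def_hermitian H"
  shows "pos_def_hermitian (matrix_inv H)"
  unfolding pos_def_hermitian_alt
proof (intro conjI allI impI)
  have inv: "invertible H" by (rule pos_def_imp_invertible[OF assms])
  have H: "transpose (cnj_mat H) = H" using assms pos_def_hermitian_alt by blast
  have "matrix_inv (transpose (cnj_mat H)) = transpose (cnj_mat (matrix_inv H))"
    by (simp add: matrix_inv_transpose matrix_inv_cnj_mat inv invertible_cnj_mat)
  then show "transpose (cnj_mat (matrix_inv H)) = matrix_inv H" by (simp add: H)
  fix z :: "complex^'a" assume z: "z \<noteq> 0"
  \<comment> \<open>With \<open>z = H *v y\<close> the form of the inverse at \<open>z\<close> is
    the conjugate of the form of \<open>H\<close> at \<open>y\<close>.\<close>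
  define y where "y = matrix_inv H *v z"
  have zy: "z = H *v y" by (simp add: y_def matrix_vector_mul_assoc matrix_inv_right inv)
  then have "y \<noteq> 0" using z by auto
  then have "Re (herm y (H *v y)) > 0" using assms pos_def_hermitian_alt by blast
  moreover have "herm z (matrix_inv H *v z) = cnj (herm y (H *v y))"
    by (simp only: y_def[symmetric] zy[symmetric] cnj_herm)
  ultimately show "Re (herm z (matrix_inv H *v z)) > 0" by simp
qed

section \<open>The metric as a sum of two traces\<close>

text \<open>For symmetric \<open>W\<close> the adjoint is \<open>cnj_mat W\<close>, so the defining
  form at \<open>z\<close> is the squared norm of \<open>z\<close> minus that of
  \<open>W *v z\<close>. The description by strict contractions serves for openness, for inverting I
  - W and for the group action.\<close>

lemma unit_disk_iff:
  "W \<in> unit_disk \<longleftrightarrow> transpose W = W \<and> (\<forall>z. z \<noteq> 0 \<longrightarrow> norm (W *v z) < norm z)"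
proof (cases "transpose W = W")
  case True
  have "herm z ((mat 1 - cnj_mat W ** W) *v z) = complex_of_real ((norm z)\<^sup>2 - (norm (W *v z))\<^sup>2)" for z
  proof -
    have "herm z (cnj_mat W *v (W *v z)) = herm (W *v z) (W *v z)"
      by (subst herm_matrix) (simp add: True del: transpose_matrix_vector)
    then show ?thesis
      by (simp add: matrix_vector_mult_diff_rdistrib herm_diff_right herm_self
          matrix_vector_mul_assoc[symmetric])
  qed
  moreover have "transpose (cnj_mat (mat 1 - cnj_mat W ** W)) = mat 1 - cnj_mat W ** W"
    by (simp add: cnj_mat_diff cnj_mat_mult transpose_diff matrix_transpose_mul True
        cnj_mat_transpose[symmetric])
  ultimately show ?thesis
    using True abs_le_square_iff[of "norm _" "norm (W *v _)"] unfolding unit_disk_def pos_def_hermitian_alt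
    by (simp add: not_le[symmetric])
qed (simp add: unit_disk_def)

section \<open>The matrices \<open>R\<close> and \<open>S\<close> at a point of the disk\<close>

locale disk_point =
  fixes W :: "complex^'n^'n"
  assumes in_disk: "W \<in> unit_disk"
begin

definition Wc where "Wc = cnj_mat W"
definition R where "R = matrix_inv (mat 1 - W ** Wc)"
definition S where "S = matrix_inv (mat 1 - Wc ** W)"

lemma sym: "transpose W = W" and sym_c: "transpose Wc = Wc"
  using in_disk by (simp_all add: unit_disk_def Wc_def cnj_mat_transpose[symmetric])

lemma pos_def: "pos_def_hermitian (mat 1 - Wc ** W)"
  using in_disk by (simp add: unit_disk_def Wc_def)

lemma invertible_S: "invertible (mat 1 - Wc ** W)"
  by (rule pos_def_imp_invertible[OF pos_def])

lemma cnj_S_inv: "cnj_mat (mat 1 - Wc ** W) = mat 1 - W ** Wc"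
  by (simp add: cnj_mat_diff cnj_mat_mult Wc_def)

lemma invertible_R: "invertible (mat 1 - W ** Wc)"
  using invertible_cnj_mat[OF invertible_S] by (simp add: cnj_S_inv)

lemma S_pos_def: "pos_def_hermitian S"
  unfolding S_def by (rule pos_def_matrix_inv[OF pos_def])

lemma cnj_S: "cnj_mat S = R"
  by (simp add: S_def R_def matrix_inv_cnj_mat[OF invertible_S, symmetric] cnj_S_inv)

lemma cnj_R: "cnj_mat R = S"
  unfolding cnj_S[symmetric] by simp

lemma transpose_S: "transpose S = R"
  using S_pos_def unfolding pos_def_hermitian_alt
  by (metis cnj_S cnj_mat_transpose cnj_mat_cnj_mat)

lemma transpose_R: "transpose R = S"
  unfolding transpose_S[symmetric] by simp

lemma S_mult: "S ** (mat 1 - Wc ** W) = mat 1" "(mat 1 - Wc ** W) ** S = mat 1"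
  by (simp_all add: S_def matrix_inv_left matrix_inv_right invertible_S)

lemma R_mult: "R ** (mat 1 - W ** Wc) = mat 1" "(mat 1 - W ** Wc) ** R = mat 1"
  by (simp_all add: R_def matrix_inv_left matrix_inv_right invertible_R)

text \<open>The push-through identity, coming from W (I - Wc W) = (I - W Wc) W.\<close>

lemma WS: "W ** S = R ** W"
proof -
  have "R ** W = R ** (W ** (mat 1 - Wc ** W)) ** S"
    by (simp add: matrix_mul_assoc[symmetric] S_mult)
  also have "W ** (mat 1 - Wc ** W) = (mat 1 - W ** Wc) ** W"
    by (simp add: matrix_distribs matrix_mul_assoc)
  finally show ?thesis by (simp add: matrix_mul_assoc R_mult)
qed

lemma WcR: "Wc ** R = S ** Wc"
  using arg_cong[OF WS, of cnj_mat] by (simp add: cnj_mat_mult cnj_S cnj_R Wc_def)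

text \<open>From R (I - W Wc) = I one has R = I + R W Wc, and \<open>WS\<close> moves
  \<open>W\<close> to the left. This is what makes the dW trace comparable with one that involves
  \<open>S\<close> alone.\<close>

lemma R_expand: "R = mat 1 + W ** S ** Wc"
  using R_mult(1) by (simp add: WS matrix_distribs matrix_mul_assoc diff_eq_eq add.commute)

text \<open>A strict contraction has no eigenvalue 1. Hence every inverse in the metric is a genuine
  one.\<close>

lemma invertible_diff: "invertible (mat 1 - W)" "invertible (mat 1 - Wc)"
proof -
  show "invertible (mat 1 - W)"
  proof (rule invertible_ker, rule ccontr)
    fix z assume "(mat 1 - W) *v z = 0" "z \<noteq> 0"
    then show False
      using in_disk unfolding unit_disk_iff
      by (simp add: matrix_vector_mult_diff_rdistrib) (metis less_irrefl)
  qed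
  from invertible_cnj_mat[OF this] show "invertible (mat 1 - Wc)"
    by (simp add: cnj_mat_diff Wc_def)
qed

text \<open>Put a = \<open>R ** U ** V'\<close> and b = \<open>S ** V ** U'\<close>. Then V' = a + R
  W, U' = b + S Wc and V' U S = a, so the sum is V' X S Wc + a X b - a X (b + S Wc) = (V' - a) X S
  Wc.\<close>

lemma last_three_terms:
  defines "U \<equiv> mat 1 - W" and "V \<equiv> mat 1 - Wc"
  shows "matrix_inv V ** X ** Wc ** R + matrix_inv V ** U ** S ** X ** S ** V ** matrix_inv U
     - R ** U ** matrix_inv V ** X ** matrix_inv U = R ** W ** X ** S ** Wc"
proof -
  define U' where "U' = matrix_inv U"
  define V' where "V' = matrix_inv V"
  have UU: "U ** U' = mat 1" "U' ** U = mat 1"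
    using invertible_diff(1) by (simp_all add: U_def U'_def matrix_inv_left matrix_inv_right)
  have VV: "V ** V' = mat 1" "V' ** V = mat 1"
    using invertible_diff(2) by (simp_all add: V_def V'_def matrix_inv_left matrix_inv_right)
  have "mat 1 - Wc ** W = V + Wc ** U"
    by (simp add: U_def V_def matrix_distribs)
  then have "S ** V + S ** Wc ** U = mat 1"
    using S_mult(1) by (simp add: matrix_add_ldistrib matrix_mul_assoc)
  from arg_cong[OF this, of "\<lambda>M. M ** U'"]
  have U': "U' = S ** V ** U' + S ** Wc"
    by (simp add: matrix_add_rdistrib matrix_mul_assoc[symmetric] UU)
  have "mat 1 - W ** Wc = U + W ** V"
    by (simp add: U_def V_def matrix_distribs)
  then have "R ** U + R ** W ** V = mat 1"
    using R_mult(1) by (simp add: matrix_add_ldistrib matrix_mul_assoc)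
  from arg_cong[OF this, of "\<lambda>M. M ** V'"]
  have V': "V' = R ** U ** V' + R ** W"
    by (simp add: matrix_add_rdistrib matrix_mul_assoc[symmetric] VV)
  have comm: "Wc ** V' = V' ** Wc"
  proof -
    have "Wc ** V' = V' ** (V ** Wc) ** V'" by (simp add: matrix_mul_assoc VV)
    also have "V ** Wc = Wc ** V" by (simp add: V_def matrix_distribs)
    finally show ?thesis by (simp add: matrix_mul_assoc[symmetric] VV)
  qed
  \<comment> \<open>Both (I - W Wc) V' U and U V' (I - Wc W) equal U + U V' Wc U, because
    \<open>Wc\<close> commutes with \<open>V'\<close>. Multiplying by \<open>R\<close> on the left
    and \<open>S\<close> on the right gives V' U S = R U V'.\<close>
  have "(mat 1 - W ** Wc) ** V' ** U = (V + U ** Wc) ** V' ** U"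
    by (simp add: U_def V_def matrix_distribs)
  also have "\<dots> = U + U ** (Wc ** V') ** U"
    by (simp add: matrix_add_rdistrib matrix_mul_assoc VV)
  also have "\<dots> = U ** V' ** (V + Wc ** U)"
    by (simp add: comm matrix_add_ldistrib) (simp add: matrix_mul_assoc[symmetric] VV)
  also have "\<dots> = U ** V' ** (mat 1 - Wc ** W)"
    by (simp add: U_def V_def matrix_distribs)
  finally have "R ** ((mat 1 - W ** Wc) ** V' ** U) ** S = R ** (U ** V' ** (mat 1 - Wc ** W)) ** S"
    by simp
  then have VUS: "V' ** U ** S = R ** U ** V'"
    by (simp add: matrix_mul_assoc R_mult) (simp add: matrix_mul_assoc[symmetric] S_mult)
  have "V' ** X ** Wc ** R + V' ** U ** S ** X ** S ** V ** U' - R ** U ** V' ** X ** U'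
    = V' ** X ** (S ** Wc) + R ** U ** V' ** X ** (S ** V ** U') - R ** U ** V' ** X ** (S ** V ** U' + S ** Wc)"
    by (simp only: WcR[symmetric] VUS U'[folded WcR, symmetric] matrix_mul_assoc)
  also have "\<dots> = (R ** U ** V' + R ** W) ** X ** (S ** Wc) - R ** U ** V' ** X ** (S ** Wc)"
    by (simp add: V'[symmetric] matrix_add_ldistrib)
  also have "\<dots> = R ** W ** X ** S ** Wc"
    by (simp add: matrix_add_rdistrib matrix_mul_assoc)
  finally show ?thesis unfolding U'_def V'_def .
qed

end

section \<open>The polarized form and its agreement with the given one\<close>

definition sj_theta :: "(complex^'n^'n) \<times> (complex^'n^'m) \<Rightarrow> (complex^'n^'n) \<times> (complex^'n^'m)
    \<Rightarrow> complex^'n^'m" where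
  "sj_theta p u = snd u +
     (snd p ** cnj_mat (fst p) - cnj_mat (snd p)) ** matrix_inv (mat 1 - fst p ** cnj_mat (fst p)) ** fst u"

text \<open>Linear in \<open>u\<close> and conjugate linear in \<open>v\<close>: the two slots
  separate a one-form from its conjugate, and the real part is the bilinear metric.\<close>

definition sj_herm :: "real \<Rightarrow> real \<Rightarrow> (complex^'n^'n) \<times> (complex^'n^'m) \<Rightarrow>
    (complex^'n^'n) \<times> (complex^'n^'m) \<Rightarrow> (complex^'n^'n) \<times> (complex^'n^'m) \<Rightarrow> complex" where
  "sj_herm A B p u v =
     4 * of_real A * trace (matrix_inv (mat 1 - fst p ** cnj_mat (fst p)) ** fst u **
        matrix_inv (mat 1 - cnj_mat (fst p) ** fst p) ** cnj_mat (fst v))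
   + 4 * of_real B * trace (sj_theta p u ** matrix_inv (mat 1 - cnj_mat (fst p) ** fst p) **
        transpose (cnj_mat (sj_theta p v)))"

context disk_point
begin

lemma sj_theta_eq: "sj_theta (W, \<eta>) (dW, d\<eta>) = d\<eta> + (\<eta> ** Wc - cnj_mat \<eta>) ** R ** dW"
  by (simp add: sj_theta_def R_def Wc_def)

lemma sj_herm_eq: "sj_herm A B (W, \<eta>) u v =
  4 * of_real A * trace (R ** fst u ** S ** cnj_mat (fst v)) +
  4 * of_real B * trace (sj_theta (W, \<eta>) u ** S ** transpose (cnj_mat (sj_theta (W, \<eta>) v)))"
  by (simp add: sj_herm_def R_def S_def Wc_def)

text \<open>Expand the \<theta>-trace with \<theta> = d\<eta> + \<phi>. The summands containing
  d\<eta> are the first three terms of the bracket, up to transposition under the trace. The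
  \<phi>-\<phi> summand splits into four: three occur literally, and the fourth is the sum found in
  \<open>last_three_terms\<close>.\<close>

lemma sj_ds2_eq_sj_herm:
  assumes dW: "transpose dW = dW"
  shows "sj_ds2 A B (W, \<eta>) (dW, d\<eta>) = sj_herm A B (W, \<eta>) (dW, d\<eta>) (dW, d\<eta>)"
proof -
  define dWc where "dWc = cnj_mat dW"
  define ec where "ec = cnj_mat \<eta>"
  define dec where "dec = cnj_mat d\<eta>"
  define X where "X = transpose ec ** \<eta>"
  define \<phi> where "\<phi> = (\<eta> ** Wc - ec) ** R ** dW"
  have dWc: "transpose dWc = dWc"
    using dW by (simp add: dWc_def cnj_mat_transpose[symmetric])
  have \<phi>': "transpose (cnj_mat \<phi>) = dWc ** R ** transpose (ec ** W - \<eta>)"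
    by (simp add: \<phi>_def cnj_mat_mult cnj_mat_diff Wc_def ec_def cnj_R matrix_transpose_mul
        dWc dWc_def[symmetric] transpose_S matrix_mul_assoc)
  have t1: "trace (R ** transpose d\<eta> ** dec) = trace (d\<eta> ** S ** transpose dec)"
    by (subst trace_transpose[symmetric])
       (simp add: matrix_transpose_mul transpose_R trace_mul_sym[of "transpose dec"])
  have t3: "trace ((ec ** W - \<eta>) ** S ** dWc ** R ** transpose d\<eta>) = trace (d\<eta> ** S ** (dWc ** R ** transpose (ec ** W - \<eta>)))"
    by (subst trace_transpose[symmetric])
       (simp add: matrix_transpose_mul transpose_R transpose_S dWc matrix_mul_assoc)
  \<comment> \<open>Multiplying out the two differences, with \<open>WS\<close> and
    \<open>WcR\<close> normalizing the positions of \<open>R\<close> and \<open>S\<close>; the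
    summand with \<open>X\<close> is the one that \<open>last_three_terms\<close> supplies.\<close>
  have q: "R ** transpose (ec ** W - \<eta>) ** (\<eta> ** Wc - ec) ** R =
      R ** W ** X ** S ** Wc - W ** S ** transpose ec ** ec ** R
      - R ** transpose \<eta> ** \<eta> ** S ** Wc + R ** transpose \<eta> ** ec ** R"
    by (simp add: X_def transpose_diff matrix_transpose_mul sym matrix_distribs matrix_mul_assoc
        WS) (simp add: matrix_mul_assoc[symmetric] WcR)
  have t4: "trace (\<phi> ** S ** (dWc ** R ** transpose (ec ** W - \<eta>))) =
    trace (R ** transpose (ec ** W - \<eta>) ** (\<eta> ** Wc - ec) ** R ** dW ** S ** dWc)"
    unfolding \<phi>_def
    using trace_mul_sym[of "R ** transpose (ec ** W - \<eta>)" "(\<eta> ** Wc - ec) ** R ** dW ** S ** dWc"]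
    by (simp add: matrix_mul_assoc)
  have expand: "trace ((d\<eta> + \<phi>) ** S ** transpose (cnj_mat (d\<eta> + \<phi>))) =
      trace (d\<eta> ** S ** transpose dec) + trace (\<phi> ** S ** transpose dec) +
      trace (d\<eta> ** S ** transpose (cnj_mat \<phi>)) + trace (\<phi> ** S ** transpose (cnj_mat \<phi>))"
    by (simp add: cnj_mat_add transpose_add matrix_distribs trace_add dec_def)
  have k: "matrix_inv (mat 1 - Wc) ** transpose ec ** \<eta> ** Wc ** R
      + matrix_inv (mat 1 - Wc) ** (mat 1 - W) ** S ** transpose ec ** \<eta> ** S ** (mat 1 - Wc) ** matrix_inv (mat 1 - W)
      - R ** (mat 1 - W) ** matrix_inv (mat 1 - Wc) ** transpose ec ** \<eta> ** matrix_inv (mat 1 - W)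
      = R ** W ** X ** S ** Wc"
    using last_three_terms[of X] by (simp add: X_def matrix_mul_assoc)
  have t5: "trace (R ** W ** X ** S ** Wc ** dW ** S ** dWc) =
      trace (matrix_inv (mat 1 - Wc) ** transpose ec ** \<eta> ** Wc ** R ** dW ** S ** dWc)
      + trace (matrix_inv (mat 1 - Wc) ** (mat 1 - W) ** S ** transpose ec ** \<eta> ** S ** (mat 1 - Wc) ** matrix_inv (mat 1 - W) ** dW ** S ** dWc)
      - trace (R ** (mat 1 - W) ** matrix_inv (mat 1 - Wc) ** transpose ec ** \<eta> ** matrix_inv (mat 1 - W) ** dW ** S ** dWc)"
    unfolding k[symmetric] matrix_add_rdistrib matrix_diff_rdistrib trace_add trace_sub ..
  have t6: "trace (\<phi> ** S ** transpose (cnj_mat \<phi>)) =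
      trace (R ** W ** X ** S ** Wc ** dW ** S ** dWc)
      - trace (W ** S ** transpose ec ** ec ** R ** dW ** S ** dWc)
      - trace (R ** transpose \<eta> ** \<eta> ** S ** Wc ** dW ** S ** dWc)
      + trace (R ** transpose \<eta> ** ec ** R ** dW ** S ** dWc)"
    unfolding \<phi>' t4 q matrix_add_rdistrib matrix_diff_rdistrib trace_add trace_sub ..
  show ?thesis
    unfolding sj_ds2_def sj_herm_eq sj_theta_eq Let_def prod.case fst_conv snd_conv
    unfolding Wc_def[symmetric] R_def[symmetric] S_def[symmetric]
      ec_def[symmetric] dec_def[symmetric] dWc_def[symmetric] \<phi>_def[symmetric]
    unfolding expand t6 t5 t1 t3 \<phi>'[symmetric]
    by (simp add: \<phi>_def matrix_mul_assoc algebra_simps)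
qed

text \<open>Conjugation exchanges \<open>R\<close> and \<open>S\<close>; a cyclic shift then
  restores the shape of the first trace and a transposition that of the second.\<close>

lemma cnj_sj_herm:
  assumes "transpose (fst u) = fst u" "transpose (fst v) = fst v"
  shows "cnj (sj_herm A B (W, \<eta>) u v) = sj_herm A B (W, \<eta>) v u"
proof -
  have "cnj (trace (R ** fst u ** S ** cnj_mat (fst v))) = trace (S ** cnj_mat (fst u) ** R ** fst v)"
    by (simp add: trace_cnj_mat[symmetric] cnj_mat_mult cnj_R cnj_S)
  also have "\<dots> = trace (R ** fst v ** S ** cnj_mat (fst u))"
    using trace_mul_sym[of "S ** cnj_mat (fst u)" "R ** fst v"] by (simp add: matrix_mul_assoc)
  finally have 1: "cnj (trace (R ** fst u ** S ** cnj_mat (fst v))) = trace (R ** fst v ** S ** cnj_mat (fst u))" .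
  have 2: "cnj (trace (X ** S ** transpose (cnj_mat Y))) = trace (Y ** S ** transpose (cnj_mat X))"
    for X Y :: "complex^'n^'m"
    by (subst trace_transpose[symmetric])
       (simp add: trace_cnj_mat[symmetric] cnj_mat_mult cnj_mat_transpose[symmetric] cnj_R cnj_S
         matrix_transpose_mul transpose_S transpose_R matrix_mul_assoc)
  show ?thesis
    unfolding sj_herm_eq by (simp add: 1 2)
qed

text \<open>By \<open>R_expand\<close> the dW trace dominates the trace of
  \<open>?Y ** S ** transpose (cnj_mat ?Y)\<close>, which is strictly positive unless dW = 0. In
  that case \<theta> is just d\<eta>, which is nonzero, and the other trace is strictly
  positive.\<close>

lemma Re_sj_herm_pos:
  assumes AB: "A > 0" "B > 0" and u: "transpose (fst u) = fst u" "u \<noteq> 0"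
  shows "Re (sj_herm A B (W, \<eta>) u u) > 0"
proof -
  let ?Y = "fst u"
  let ?\<theta> = "sj_theta (W, \<eta>) u"
  have Yc: "cnj_mat ?Y = transpose (cnj_mat ?Y)"
    by (simp add: cnj_mat_transpose[symmetric] u)
  have S: "psd_hermitian S" by (rule pos_def_imp_psd[OF S_pos_def])
  have WSW: "psd_hermitian (W ** S ** Wc)"
    using psd_congruence[OF S, of Wc] by (simp add: Wc_def sym)
  have YSY: "psd_hermitian (?Y ** S ** cnj_mat ?Y)"
    using psd_congruence[OF S, of "cnj_mat ?Y"] by (simp add: u)
  have "trace (R ** ?Y ** S ** cnj_mat ?Y) = trace (?Y ** S ** cnj_mat ?Y ** R)"
    by (metis matrix_mul_assoc trace_mul_sym)
  also have "\<dots> = trace (?Y ** S ** transpose (cnj_mat ?Y)) + trace (?Y ** S ** cnj_mat ?Y ** (W ** S ** Wc))"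
    by (subst R_expand) (simp add: matrix_add_ldistrib trace_add Yc[symmetric])
  finally have tr: "Re (trace (R ** ?Y ** S ** cnj_mat ?Y)) \<ge> Re (trace (?Y ** S ** transpose (cnj_mat ?Y)))"
    using trace_psd_mult_nonneg[OF YSY WSW] by simp
  have \<theta>: "Re (trace (?\<theta> ** S ** transpose (cnj_mat ?\<theta>))) \<ge> 0"
    by (rule trace_congruence_nonneg[OF S])
  have "A * Re (trace (R ** ?Y ** S ** cnj_mat ?Y)) + B * Re (trace (?\<theta> ** S ** transpose (cnj_mat ?\<theta>))) > 0"
  proof (cases "?Y = 0")
    case True
    then have "?\<theta> \<noteq> 0" using u
      by (cases u) (auto simp: sj_theta_eq matrix_matrix_mult_def vec_eq_iff zero_prod_def)
    moreover have "trace (R ** ?Y ** S ** cnj_mat ?Y) = 0"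
      unfolding True by (simp add: trace_def matrix_matrix_mult_def)
    ultimately show ?thesis using trace_congruence_pos[OF S_pos_def, of ?\<theta>] AB by simp
  next
    case False
    then show ?thesis using trace_congruence_pos[OF S_pos_def, of ?Y] tr \<theta> AB
      by (intro add_pos_nonneg mult_pos_pos mult_nonneg_nonneg) auto
  qed
  then show ?thesis unfolding sj_herm_eq by simp
qed

end

section \<open>Smoothness\<close>

lemma Ck_on_Suc_imp: "Ck_on (Suc k) E D f \<Longrightarrow> Ck_on k E D f"
proof (induction k arbitrary: f)
  case 0
  then show ?case
    by (auto simp: continuous_on_eq_continuous_within intro: has_derivative_continuous)
next
  case (Suc k)
  then show ?case by (metis Ck_on.simps(2))
qed

text \<open>Agreement on \<open>D\<close> is enough because derivatives are taken within
  \<open>D\<close>. This lets Cramer's formula stand in for \<open>matrix_inv\<close>, with which it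
  agrees at invertible matrices.\<close>

lemma Ck_on_cong:
  assumes "\<And>p. p \<in> D \<Longrightarrow> f p = g p" and "Ck_on k E D f"
  shows "Ck_on k E D g"
proof (cases k)
  case 0
  then show ?thesis using assms continuous_on_cong[of D D f g] by simp
next
  case (Suc l)
  with assms(2) obtain f' where f': "\<And>p. p \<in> D \<Longrightarrow> (f has_derivative f' p) (at p within D)"
    "\<And>v. v \<in> E \<Longrightarrow> Ck_on l E D (\<lambda>p. f' p v)" by auto
  have "(g has_derivative f' p) (at p within D)" if "p \<in> D" for p
    using has_derivative_transform[OF that _ f'(1)[OF that], of g] assms(1) by simp
  then show ?thesis using f'(2) Suc by auto
qed

lemma Ck_on_const: "Ck_on k E D (\<lambda>p. c)"
  by (induction k arbitrary: c) (auto intro!: exI[of _ "\<lambda>p v. 0"])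

lemma Ck_on_linear:
  assumes "bounded_linear f"
  shows "Ck_on k E D f"
proof (cases k)
  case 0
  then show ?thesis using assms by (simp add: linear_continuous_on)
next
  case (Suc l)
  have "\<forall>p\<in>D. (f has_derivative f) (at p within D)"
    using assms by (simp add: bounded_linear_imp_has_derivative)
  then show ?thesis
    unfolding Suc Ck_on.simps by (intro exI[of _ "\<lambda>p. f"] conjI) (simp_all add: Ck_on_const)
qed

lemma Ck_on_add:
  "Ck_on k E D f \<Longrightarrow> Ck_on k E D g \<Longrightarrow> Ck_on k E D (\<lambda>p. f p + g p)"
proof (induction k arbitrary: f g)
  case 0
  then show ?case by (auto intro: continuous_intros)
next
  case (Suc k)
  from Suc.prems(1) obtain f' where f': "\<And>p. p \<in> D \<Longrightarrow> (f has_derivative f' p) (at p within D)"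
    "\<And>v. v \<in> E \<Longrightarrow> Ck_on k E D (\<lambda>p. f' p v)" by auto
  from Suc.prems(2) obtain g' where g': "\<And>p. p \<in> D \<Longrightarrow> (g has_derivative g' p) (at p within D)"
    "\<And>v. v \<in> E \<Longrightarrow> Ck_on k E D (\<lambda>p. g' p v)" by auto
  show ?case
    unfolding Ck_on.simps
    by (intro exI[of _ "\<lambda>p v. f' p v + g' p v"] conjI ballI Suc.IH f' g' has_derivative_add)
qed

lemma Ck_on_mult:
  "Ck_on k E D f \<Longrightarrow> Ck_on k E D g \<Longrightarrow> Ck_on k E D (\<lambda>p. f p * g p)"
proof (induction k arbitrary: f g)
  case 0
  then show ?case by (auto intro: continuous_intros)
next
  case (Suc k)
  from Suc.prems(1) obtain f' where f': "\<And>p. p \<in> D \<Longrightarrow> (f has_derivative f' p) (at p within D)"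
    "\<And>v. v \<in> E \<Longrightarrow> Ck_on k E D (\<lambda>p. f' p v)" by auto
  from Suc.prems(2) obtain g' where g': "\<And>p. p \<in> D \<Longrightarrow> (g has_derivative g' p) (at p within D)"
    "\<And>v. v \<in> E \<Longrightarrow> Ck_on k E D (\<lambda>p. g' p v)" by auto
  show ?case
    unfolding Ck_on.simps
    \<comment> \<open>The product rule contains \<open>f\<close> and \<open>g\<close> themselves, so
      they are needed at the lower order too.\<close>
    by (intro exI[of _ "\<lambda>p v. f p * g' p v + f' p v * g p"] conjI ballI Ck_on_add Suc.IH f' g'
        has_derivative_mult Suc.prems[THEN Ck_on_Suc_imp])
qed

lemma Ck_on_uminus: "Ck_on k E D f \<Longrightarrow> Ck_on k E D (\<lambda>p. - f p)"
  using Ck_on_mult[OF Ck_on_const[of k E D "-1"], of f] by simp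

lemma Ck_on_diff:
  "Ck_on k E D f \<Longrightarrow> Ck_on k E D g \<Longrightarrow> Ck_on k E D (\<lambda>p. f p - g p)"
  using Ck_on_add[OF _ Ck_on_uminus, of k E D f g] by simp

text \<open>The derivative of 1/f is a product of \<open>f'\<close> and 1/f itself, and the
  induction hypothesis supplies 1/f one order lower.\<close>

lemma Ck_on_inverse:
  "Ck_on k E D f \<Longrightarrow> (\<And>p. p \<in> D \<Longrightarrow> f p \<noteq> 0) \<Longrightarrow> Ck_on k E D (\<lambda>p. inverse (f p))"
proof (induction k)
  case 0
  then show ?case by (auto intro: continuous_on_inverse)
next
  case (Suc k)
  from Suc.prems(1) obtain f' where f': "\<And>p. p \<in> D \<Longrightarrow> (f has_derivative f' p) (at p within D)"
    "\<And>v. v \<in> E \<Longrightarrow> Ck_on k E D (\<lambda>p. f' p v)" by auto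
  have "((\<lambda>p. inverse (f p)) has_derivative (\<lambda>v. - (inverse (f p) * f' p v * inverse (f p))))
      (at p within D)" if "p \<in> D" for p
    using Deriv.has_derivative_inverse[OF Suc.prems(2)[OF that] f'(1)[OF that]] .
  moreover have inv: "Ck_on k E D (\<lambda>p. inverse (f p))"
    using Suc Ck_on_Suc_imp by blast
  ultimately show ?case
    unfolding Ck_on.simps
    by (intro exI[of _ "\<lambda>p v. - (inverse (f p) * f' p v * inverse (f p))"] conjI ballI
        Ck_on_uminus Ck_on_mult f') blast+
qed

section \<open>Smoothness of complex-valued and matrix-valued functions\<close>

definition csmooth_on :: "'a::euclidean_space set \<Rightarrow> 'a set \<Rightarrow> ('a \<Rightarrow> complex) \<Rightarrow> bool" where
  "csmooth_on E D f \<longleftrightarrow> smooth_on E D (\<lambda>p. Re (f p)) \<and> smooth_on E D (\<lambda>p. Im (f p))"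

lemma csmooth_on_cong:
  "(\<And>p. p \<in> D \<Longrightarrow> f p = g p) \<Longrightarrow> csmooth_on E D f \<Longrightarrow> csmooth_on E D g"
  unfolding csmooth_on_def smooth_on_def
  using Ck_on_cong[of D "\<lambda>p. Re (f p)" "\<lambda>p. Re (g p)"] Ck_on_cong[of D "\<lambda>p. Im (f p)" "\<lambda>p. Im (g p)"]
  by simp

lemma csmooth_on_const: "csmooth_on E D (\<lambda>p. c)"
  by (simp add: csmooth_on_def smooth_on_def Ck_on_const)

lemma csmooth_on_linear: "bounded_linear f \<Longrightarrow> csmooth_on E D f"
  unfolding csmooth_on_def smooth_on_def
  by (intro conjI allI Ck_on_linear bounded_linear_compose[OF bounded_linear_Re]
      bounded_linear_compose[OF bounded_linear_Im])

lemma csmooth_on_add: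
  "csmooth_on E D f \<Longrightarrow> csmooth_on E D g \<Longrightarrow> csmooth_on E D (\<lambda>p. f p + g p)"
  by (simp add: csmooth_on_def smooth_on_def Ck_on_add)

lemma csmooth_on_mult:
  "csmooth_on E D f \<Longrightarrow> csmooth_on E D g \<Longrightarrow> csmooth_on E D (\<lambda>p. f p * g p)"
  by (simp add: csmooth_on_def smooth_on_def Ck_on_add Ck_on_diff Ck_on_mult)

lemma csmooth_on_diff:
  "csmooth_on E D f \<Longrightarrow> csmooth_on E D g \<Longrightarrow> csmooth_on E D (\<lambda>p. f p - g p)"
  by (simp add: csmooth_on_def smooth_on_def Ck_on_diff)

lemma csmooth_on_cnj: "csmooth_on E D f \<Longrightarrow> csmooth_on E D (\<lambda>p. cnj (f p))"
  by (simp add: csmooth_on_def smooth_on_def Ck_on_uminus)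

lemma csmooth_on_inverse:
  assumes "csmooth_on E D f" and "\<And>p. p \<in> D \<Longrightarrow> f p \<noteq> 0"
  shows "csmooth_on E D (\<lambda>p. inverse (f p))"
proof -
  have "Re (f p) * Re (f p) + Im (f p) * Im (f p) \<noteq> 0" if "p \<in> D" for p
    using assms(2)[OF that] complex_neq_0[of "f p"] by (metis power2_eq_square less_irrefl)
  then show ?thesis using assms(1)
    unfolding csmooth_on_def smooth_on_def inverse_complex.simps power2_eq_square divide_inverse
    by (intro conjI allI Ck_on_mult Ck_on_uminus Ck_on_inverse Ck_on_add) auto
qed

lemma csmooth_on_sum:
  "(\<And>i. i \<in> S \<Longrightarrow> csmooth_on E D (f i)) \<Longrightarrow> csmooth_on E D (\<lambda>p. \<Sum>i\<in>S. f i p)"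
  by (induction S rule: infinite_finite_induct) (auto intro: csmooth_on_const csmooth_on_add)

lemma csmooth_on_prod:
  "(\<And>i. i \<in> S \<Longrightarrow> csmooth_on E D (f i)) \<Longrightarrow> csmooth_on E D (\<lambda>p. \<Prod>i\<in>S. f i p)"
  by (induction S rule: infinite_finite_induct) (auto intro: csmooth_on_const csmooth_on_mult)

lemma csmooth_on_det:
  "(\<And>i j. csmooth_on E D (\<lambda>p. M p $ i $ j)) \<Longrightarrow> csmooth_on E D (\<lambda>p. det (M p :: complex^'n^'n))"
  unfolding det_def by (intro csmooth_on_sum csmooth_on_mult csmooth_on_prod csmooth_on_const)

text \<open>Column \<open>j\<close> of the inverse solves A x = \<open>axis j 1\<close>. Cramer's
  rule makes its entries quotients of polynomials in the entries of \<open>A\<close>, which reduces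
  smoothness of inversion to sums, products and one reciprocal.\<close>

lemma matrix_inv_cramer:
  fixes A :: "'a::field^'n^'n"
  assumes "invertible A"
  shows "matrix_inv A $ i $ j = det (\<chi> k l. if l = i then axis j 1 $ k else A $ k $ l) / det A"
proof -
  have "A *v (matrix_inv A *v axis j 1) = axis j 1"
    using assms by (simp add: matrix_vector_mul_assoc matrix_inv_right)
  then have "matrix_inv A *v axis j 1 = (\<chi> i. det (\<chi> k l. if l = i then axis j 1 $ k else A $ k $ l) / det A)"
    using assms by (subst (asm) cramer) (auto simp: invertible_det_nz)
  moreover have "(matrix_inv A *v axis j 1) $ i = matrix_inv A $ i $ j"
    by (simp add: matrix_vector_mult_def axis_def if_distrib cong: if_cong)
  ultimately show ?thesis by (simp add: vec_eq_iff)
qed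

lemma csmooth_on_matrix_inv:
  fixes M :: "'a::euclidean_space \<Rightarrow> complex^'n^'n"
  assumes "\<And>p. p \<in> D \<Longrightarrow> invertible (M p)" "\<And>i j. csmooth_on E D (\<lambda>p. M p $ i $ j)"
  shows "csmooth_on E D (\<lambda>p. matrix_inv (M p) $ i $ j)"
proof (rule csmooth_on_cong)
  show "det (\<chi> k l. if l = i then axis j 1 $ k else M p $ k $ l) * inverse (det (M p))
    = matrix_inv (M p) $ i $ j" if "p \<in> D" for p
    using matrix_inv_cramer[OF assms(1)[OF that]] by (simp add: divide_inverse)
  have "csmooth_on E D (\<lambda>p. (\<chi> k l. if l = i then axis j 1 $ k else M p $ k $ l) $ k $ l)" for k l
    by (cases "l = i") (auto intro: assms csmooth_on_const)
  then show "csmooth_on E D (\<lambda>p. det (\<chi> k l. if l = i then axis j 1 $ k else M p $ k $ l) * inverse (det (M p)))"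
    by (intro csmooth_on_mult csmooth_on_inverse csmooth_on_det assms)
       (use assms(1) in \<open>auto simp: invertible_det_nz\<close>)
qed

definition msmooth_on :: "'a::euclidean_space set \<Rightarrow> 'a set \<Rightarrow> ('a \<Rightarrow> complex^'l^'k) \<Rightarrow> bool" where
  "msmooth_on E D f \<longleftrightarrow> (\<forall>i j. csmooth_on E D (\<lambda>p. f p $ i $ j))"

lemma msmooth_on_const: "msmooth_on E D (\<lambda>p. M)"
  by (simp add: msmooth_on_def csmooth_on_const)

lemma msmooth_on_linear: "bounded_linear f \<Longrightarrow> msmooth_on E D f"
  unfolding msmooth_on_def
  by (intro allI csmooth_on_linear bounded_linear_compose[OF bounded_linear_vec_nth]) auto

lemma msmooth_on_add: "msmooth_on E D f \<Longrightarrow> msmooth_on E D g \<Longrightarrow> msmooth_on E D (\<lambda>p. f p + g p)"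
  by (simp add: msmooth_on_def csmooth_on_add)

lemma msmooth_on_diff: "msmooth_on E D f \<Longrightarrow> msmooth_on E D g \<Longrightarrow> msmooth_on E D (\<lambda>p. f p - g p)"
  by (simp add: msmooth_on_def csmooth_on_diff)

lemma msmooth_on_mult: "msmooth_on E D f \<Longrightarrow> msmooth_on E D g \<Longrightarrow> msmooth_on E D (\<lambda>p. f p ** g p)"
  by (simp add: msmooth_on_def matrix_matrix_mult_def csmooth_on_sum csmooth_on_mult)

lemma msmooth_on_cnj_mat: "msmooth_on E D f \<Longrightarrow> msmooth_on E D (\<lambda>p. cnj_mat (f p))"
  by (simp add: msmooth_on_def csmooth_on_cnj)

lemma msmooth_on_transpose: "msmooth_on E D f \<Longrightarrow> msmooth_on E D (\<lambda>p. transpose (f p))"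
  by (simp add: msmooth_on_def)

lemma msmooth_on_matrix_inv:
  fixes f :: "'a::euclidean_space \<Rightarrow> complex^'n^'n"
  shows "msmooth_on E D f \<Longrightarrow> (\<And>p. p \<in> D \<Longrightarrow> invertible (f p)) \<Longrightarrow> msmooth_on E D (\<lambda>p. matrix_inv (f p))"
  unfolding msmooth_on_def by (intro allI csmooth_on_matrix_inv) auto

lemma csmooth_on_trace: "msmooth_on E D f \<Longrightarrow> csmooth_on E D (\<lambda>p. trace (f p))"
  by (simp add: msmooth_on_def trace_def csmooth_on_sum)

lemma smooth_on_Re: "csmooth_on E D f \<Longrightarrow> smooth_on E D (\<lambda>p. Re (f p))"
  by (simp add: csmooth_on_def)

section \<open>The Riemannian metric\<close>

lemma csmooth_on_sj_herm:
  "csmooth_on sj_tangent sj_disk (\<lambda>p :: (complex^'n^'n) \<times> (complex^'n^'m). sj_herm A B p u v)"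
proof -
  have inv: "invertible (mat 1 - fst p ** cnj_mat (fst p))" "invertible (mat 1 - cnj_mat (fst p) ** fst p)"
    if "p \<in> sj_disk" for p :: "(complex^'n^'n) \<times> (complex^'n^'m)"
  proof -
    interpret disk_point "fst p" using that by unfold_locales (auto simp: sj_disk_def)
    show "invertible (mat 1 - fst p ** cnj_mat (fst p))" "invertible (mat 1 - cnj_mat (fst p) ** fst p)"
      using invertible_R invertible_S by (simp_all add: Wc_def)
  qed
  show ?thesis
    unfolding sj_herm_def sj_theta_def
    by (intro csmooth_on_add csmooth_on_mult csmooth_on_const csmooth_on_trace msmooth_on_mult
        msmooth_on_add msmooth_on_diff msmooth_on_transpose msmooth_on_cnj_mat msmooth_on_matrix_inv
        msmooth_on_const msmooth_on_linear bounded_linear_fst bounded_linear_snd inv)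
qed

section \<open>Openness of the disk and linearity of the form\<close>

lemma bounded_bilinear_matrix_mult:
  "bounded_bilinear ((**) :: complex^'k^'n \<Rightarrow> complex^'m^'k \<Rightarrow> complex^'m^'n)"
  unfolding bilinear_conv_bounded_bilinear[symmetric] bilinear_def linear_iff
  by (simp add: matrix_add_ldistrib matrix_add_rdistrib vec_eq_iff matrix_matrix_mult_def scaleR_sum_right
      algebra_simps sum.distrib)

lemma bounded_bilinear_matrix_vector_mult:
  "bounded_bilinear ((*v) :: complex^'k^'n \<Rightarrow> complex^'k \<Rightarrow> complex^'n)"
  unfolding bilinear_conv_bounded_bilinear[symmetric] bilinear_def linear_iff
  by (simp add: vec_eq_iff matrix_vector_mult_def scaleR_sum_right algebra_simps sum.distrib)

text \<open>Pointwise strictness becomes uniform by compactness of the unit sphere: the operator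
  norm \<open>c\<close> of \<open>W\<close> is attained, hence below 1, and a perturbation smaller
  than \<open>(1 - c) / K\<close> keeps the matrix a strict contraction.\<close>

lemma open_contractions: "open {W :: complex^'n^'n. \<forall>z. z \<noteq> 0 \<longrightarrow> norm (W *v z) < norm z}"
proof (rule openI)
  fix W :: "complex^'n^'n"
  assume W: "W \<in> {W. \<forall>z. z \<noteq> 0 \<longrightarrow> norm (W *v z) < norm z}"
  obtain K where K: "K > 0" "\<And>M (z :: complex^'n). norm ((M :: complex^'n^'n) *v z) \<le> norm M * norm z * K"
    using bounded_bilinear.pos_bounded[OF bounded_bilinear_matrix_vector_mult] by blast
  have "compact (sphere (0 :: complex^'n) 1)" "sphere (0 :: complex^'n) 1 \<noteq> {}" by auto
  moreover have "continuous_on (sphere 0 1) (\<lambda>z. norm (W *v z))"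
    by (intro continuous_on_norm linear_continuous_on
        bounded_bilinear.bounded_linear_right[OF bounded_bilinear_matrix_vector_mult])
  ultimately obtain x where x: "x \<in> sphere 0 1" "\<And>z. z \<in> sphere 0 1 \<Longrightarrow> norm (W *v z) \<le> norm (W *v x)"
    using continuous_attains_sup by metis
  define c where "c = norm (W *v x)"
  have "x \<noteq> 0" using x(1) by auto
  then have c: "c < 1" using W x(1) unfolding c_def by force
  have le: "norm (W *v z) \<le> c * norm z" for z
  proof (cases "z = 0")
    case False
    have "z = norm z *\<^sub>R ((1 / norm z) *\<^sub>R z)" using False by simp
    then have "norm (W *v z) = norm z * norm (W *v ((1 / norm z) *\<^sub>R z))"
      by (metis bounded_bilinear.scaleR_right[OF bounded_bilinear_matrix_vector_mult] norm_scaleR abs_norm_cancel)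
    also have "norm (W *v ((1 / norm z) *\<^sub>R z)) \<le> c"
      unfolding c_def using False by (intro x(2)) simp
    finally show ?thesis using False by (simp add: mult.commute)
  qed simp
  have "ball W ((1 - c) / K) \<subseteq> {W :: complex^'n^'n. \<forall>z. z \<noteq> 0 \<longrightarrow> norm (W *v z) < norm z}"
  proof (intro subsetI CollectI allI impI)
    fix V and z :: "complex^'n" assume V: "V \<in> ball W ((1 - c) / K)" and z: "z \<noteq> 0"
    have nz: "norm z > 0" using z by simp
    have "V *v z = W *v z + (V - W) *v z" by (simp add: matrix_vector_mult_diff_rdistrib)
    then have "norm (V *v z) \<le> norm (W *v z) + norm ((V - W) *v z)" by (metis norm_triangle_ineq)
    also have "\<dots> \<le> c * norm z + norm (V - W) * norm z * K" using le K(2) add_mono by blast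
    also have "\<dots> = (c + norm (V - W) * K) * norm z" by (simp add: algebra_simps)
    also have "\<dots> < 1 * norm z"
    proof (rule mult_strict_right_mono[OF _ nz])
      have "norm (V - W) < (1 - c) / K" using V by (simp add: dist_norm norm_minus_commute)
      then show "c + norm (V - W) * K < 1" using K(1) by (simp add: field_simps)
    qed
    finally show "norm (V *v z) < norm z" by simp
  qed
  moreover have "(1 - c) / K > 0" using c K(1) by simp
  ultimately show "\<exists>e>0. ball W e \<subseteq> {W. \<forall>z. z \<noteq> 0 \<longrightarrow> norm (W *v z) < norm z}"
    by blast
qed

lemma openin_sj_disk:
  "openin (top_of_set sj_tangent) (sj_disk :: ((complex^'n^'n) \<times> (complex^'n^'m)) set)"
proof -
  have "sj_disk = sj_tangent \<inter> ({W :: complex^'n^'n. \<forall>z. z \<noteq> 0 \<longrightarrow> norm (W *v z) < norm z} \<times> (UNIV :: (complex^'n^'m) set))"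
    by (auto simp: sj_disk_def sj_tangent_def unit_disk_iff)
  then show ?thesis
    unfolding openin_open using open_Times[OF open_contractions open_UNIV] by blast
qed

lemma subspace_sj_tangent: "subspace (sj_tangent :: ((complex^'n^'n) \<times> (complex^'n^'m)) set)"
  by (auto simp: subspace_def sj_tangent_def transpose_add transpose_scalar zero_prod_def)
     (simp add: vec_eq_iff)

lemma sj_theta_linear:
  "sj_theta p (a *\<^sub>R u + b *\<^sub>R v) = a *\<^sub>R sj_theta p u + b *\<^sub>R sj_theta p v"
  unfolding sj_theta_def
  by (simp add: bounded_bilinear.add_right[OF bounded_bilinear_matrix_mult]
      bounded_bilinear.scaleR_right[OF bounded_bilinear_matrix_mult] algebra_simps)

lemma trace_scaleR: "trace (a *\<^sub>R M) = a *\<^sub>R trace M" for M :: "complex^'n^'n"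
  by (simp add: trace_def scaleR_sum_right)

lemma sj_herm_linear:
  "sj_herm A B p (a *\<^sub>R u + b *\<^sub>R v) w = a *\<^sub>R sj_herm A B p u w + b *\<^sub>R sj_herm A B p v w"
proof -
  have *: "trace (X ** (a *\<^sub>R U + b *\<^sub>R V) ** Y ** Z) =
      a *\<^sub>R trace (X ** U ** Y ** Z) + b *\<^sub>R trace (X ** V ** Y ** Z)"
    for X U V Y Z :: "complex^'n^'n"
    by (simp add: bounded_bilinear.add_right[OF bounded_bilinear_matrix_mult]
        bounded_bilinear.add_left[OF bounded_bilinear_matrix_mult]
      bounded_bilinear.scaleR_right[OF bounded_bilinear_matrix_mult]
      bounded_bilinear.scaleR_left[OF bounded_bilinear_matrix_mult] trace_add trace_scaleR)
  have **: "trace ((a *\<^sub>R U + b *\<^sub>R V) ** Y ** Z) = a *\<^sub>R trace (U ** Y ** Z) + b *\<^sub>R trace (V ** Y ** Z)"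
    for U V :: "complex^'n^'m" and Y :: "complex^'n^'n" and Z :: "complex^'m^'n"
    by (simp add: bounded_bilinear.add_left[OF bounded_bilinear_matrix_mult]
      bounded_bilinear.scaleR_left[OF bounded_bilinear_matrix_mult] trace_add trace_scaleR)
  show ?thesis
    unfolding sj_herm_def sj_theta_linear fst_add fst_scaleR * **
    by (simp add: algebra_simps scaleR_conv_of_real)
qed

lemma riemannian_metric_sj_herm:
  assumes "A > 0" "B > 0"
  shows "riemannian_metric_on (sj_tangent :: ((complex^'n^'n) \<times> (complex^'n^'m)) set) sj_disk
    (\<lambda>p u v. Re (sj_herm A B p u v))"
proof -
  have *: "disk_point (fst p)" if "p \<in> sj_disk" for p :: "(complex^'n^'n) \<times> (complex^'n^'m)"
    using that by unfold_locales (auto simp: sj_disk_def)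
  have sym: "Re (sj_herm A B p u v) = Re (sj_herm A B p v u)"
    if "p \<in> sj_disk" "u \<in> sj_tangent" "v \<in> sj_tangent" for p u v :: "(complex^'n^'n) \<times> (complex^'n^'m)"
  proof -
    have "transpose (fst u) = fst u" "transpose (fst v) = fst v"
      using that by (auto simp: sj_tangent_def)
    from disk_point.cnj_sj_herm[OF *[OF that(1)] this, of A B "snd p"]
    have "cnj (sj_herm A B p u v) = sj_herm A B p v u" by simp
    then show ?thesis by (metis cnj.sel(1))
  qed
  have pos: "Re (sj_herm A B p v v) > 0"
    if "p \<in> sj_disk" "v \<in> sj_tangent" "v \<noteq> 0" for p v :: "(complex^'n^'n) \<times> (complex^'n^'m)"
  proof -
    have "transpose (fst v) = fst v" using that by (auto simp: sj_tangent_def)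
    from disk_point.Re_sj_herm_pos[OF *[OF that(1)] assms this that(3), of "snd p"]
    show ?thesis by simp
  qed
  show ?thesis
    unfolding riemannian_metric_on_def
    by (intro conjI ballI allI impI subspace_sj_tangent openin_sj_disk smooth_on_Re csmooth_on_sj_herm
        sym pos) (simp_all add: sj_herm_linear)
qed

section \<open>The derivative of matrix inversion\<close>

lemma open_invertible: "open {M :: complex^'n^'n. invertible M}"
proof -
  have "continuous_on UNIV (\<lambda>M :: complex^'n^'n. det M)"
    unfolding det_def by (intro continuous_intros)
  then have "open ((\<lambda>M :: complex^'n^'n. det M) -` (- {0}))"
    by (intro open_vimage) auto
  moreover have "(\<lambda>M :: complex^'n^'n. det M) -` (- {0}) = {M. invertible M}"
    by (auto simp: invertible_det_nz)
  ultimately show ?thesis by simp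
qed

lemma csmooth_on_imp_continuous_on:
  assumes "csmooth_on E D f"
  shows "continuous_on D f"
proof -
  have "Ck_on 0 E D (\<lambda>p. Re (f p))" "Ck_on 0 E D (\<lambda>p. Im (f p))"
    using assms unfolding csmooth_on_def smooth_on_def by blast+
  then have "continuous_on D (\<lambda>p. complex_of_real (Re (f p)) + \<i> * complex_of_real (Im (f p)))"
    by (intro continuous_on_add continuous_on_mult continuous_on_const continuous_on_of_real) simp_all
  then show ?thesis by (simp add: complex_eq[symmetric])
qed

text \<open>Order zero of the smoothness result, applied to the identity map on the invertible
  matrices.\<close>

lemma continuous_on_matrix_inv: "continuous_on {M :: complex^'n^'n. invertible M} matrix_inv"
proof -
  have "msmooth_on UNIV {M :: complex^'n^'n. invertible M} (\<lambda>M. matrix_inv M)"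
    by (intro msmooth_on_matrix_inv msmooth_on_linear) (auto simp: bounded_linear_ident)
  then have "continuous_on {M :: complex^'n^'n. invertible M} (\<lambda>M. matrix_inv M $ i $ j)" for i j
    unfolding msmooth_on_def using csmooth_on_imp_continuous_on by blast
  then have "continuous_on {M :: complex^'n^'n. invertible M} (\<lambda>M. \<chi> i j. matrix_inv M $ i $ j)"
    by (intro continuous_on_vec_lambda)
  then show ?thesis by simp
qed

text \<open>With N the inverse of \<open>M\<close>, the remainder at \<open>Y\<close> is exactly (N
  - \<open>matrix_inv Y\<close>) (Y - M) N. Its first factor tends to zero by continuity of
  inversion, so the remainder is of smaller order than Y - M.\<close>

lemma has_derivative_matrix_inv_at:
  fixes M :: "complex^'n^'n"
  assumes M: "invertible M"
  shows "(matrix_inv has_derivative (\<lambda>v. - (matrix_inv M ** v ** matrix_inv M))) (at M)"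
proof -
  obtain K where K: "K > 0" "\<And>A B. norm ((A :: complex^'n^'n) ** (B :: complex^'n^'n)) \<le> norm A * norm B * K"
    using bounded_bilinear.pos_bounded[OF bounded_bilinear_matrix_mult] by blast
  let ?N = "matrix_inv M"
  have lin: "bounded_linear (\<lambda>v. - (?N ** v ** ?N))"
    by (intro bounded_linear_minus bounded_linear_compose[OF bounded_bilinear.bounded_linear_left[OF bounded_bilinear_matrix_mult]]
        bounded_bilinear.bounded_linear_right[OF bounded_bilinear_matrix_mult])
  have eq: "matrix_inv Y - ?N - - (?N ** (Y - M) ** ?N) = (?N - matrix_inv Y) ** (Y - M) ** ?N"
    if "invertible Y" for Y
  proof -
    have "matrix_inv Y ** (Y - M) ** ?N = ?N - matrix_inv Y"
      by (simp add: matrix_diff_ldistrib matrix_diff_rdistrib matrix_inv_left that)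
         (simp add: matrix_mul_assoc[symmetric] matrix_inv_right M)
    then show ?thesis by (simp add: matrix_diff_rdistrib)
  qed
  have bound: "norm (norm (matrix_inv Y - ?N - - (?N ** (Y - M) ** ?N)) / norm (Y - M))
      \<le> norm (?N - matrix_inv Y) * (K * norm ?N * K)" if "invertible Y" for Y
  proof -
    have "norm ((?N - matrix_inv Y) ** (Y - M) ** ?N) \<le> norm ((?N - matrix_inv Y) ** (Y - M)) * norm ?N * K"
      by (rule K)
    also have "\<dots> \<le> (norm (?N - matrix_inv Y) * norm (Y - M) * K) * norm ?N * K"
      using K by (intro mult_right_mono) auto
    finally show ?thesis unfolding eq[OF that] using K(1)
      by (cases "Y = M") (simp_all add: divide_simps mult_ac)
  qed
  have ev: "eventually (\<lambda>Y. invertible Y) (at M)"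
    using eventually_at_topological open_invertible M by blast
  have "isCont matrix_inv M"
    using continuous_on_matrix_inv open_invertible M by (metis continuous_on_eq_continuous_at mem_Collect_eq)
  then have "((\<lambda>Y. norm (?N - matrix_inv Y) * (K * norm ?N * K)) \<longlongrightarrow> norm (?N - ?N) * (K * norm ?N * K)) (at M)"
    unfolding isCont_def by (intro tendsto_intros)
  then have "((\<lambda>Y. norm (?N - matrix_inv Y) * (K * norm ?N * K)) \<longlongrightarrow> 0) (at M)" by simp
  then have "((\<lambda>Y. norm (matrix_inv Y - ?N - - (?N ** (Y - M) ** ?N)) / norm (Y - M)) \<longlongrightarrow> 0) (at M)"
    by (rule Lim_null_comparison[rotated]) (rule eventually_mono[OF ev bound])
  then show ?thesis using lin by (simp add: has_derivative_iff_norm)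
qed

lemma has_derivative_matrix_inv:
  fixes f :: "'a::real_normed_vector \<Rightarrow> complex^'n^'n"
  assumes "(f has_derivative f') (at x within D)" "invertible (f x)"
  shows "((\<lambda>y. matrix_inv (f y)) has_derivative
    (\<lambda>v. - (matrix_inv (f x) ** f' v ** matrix_inv (f x)))) (at x within D)"
  using has_derivative_compose[OF assms(1) has_derivative_matrix_inv_at[OF assms(2)]] .

lemmas has_derivative_matrix_mult = bounded_bilinear.FDERIV[OF bounded_bilinear_matrix_mult]

section \<open>Invariance under the Jacobi group\<close>

lemma sum_Plus: "(\<Sum>i\<in>UNIV. f i) = (\<Sum>a\<in>UNIV. f (Inl a)) + (\<Sum>b\<in>UNIV. f (Inr b))"
  for f :: "'a::finite + 'b::finite \<Rightarrow> 'c::comm_monoid_add"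
  by (subst UNIV_Plus_UNIV[symmetric], subst sum.Plus) auto

lemma block_mat_nth [simp]:
  "block_mat P Q R S $ Inl a $ Inl b = P $ a $ b" "block_mat P Q R S $ Inl a $ Inr b = Q $ a $ b"
  "block_mat P Q R S $ Inr a $ Inl b = R $ a $ b" "block_mat P Q R S $ Inr a $ Inr b = S $ a $ b"
  by (simp_all add: block_mat_def)

lemma block_mat_eq_iff:
  "block_mat P Q R S = block_mat P' Q' R' S' \<longleftrightarrow> P = P' \<and> Q = Q' \<and> R = R' \<and> S = S'"
proof
  assume eq: "block_mat P Q R S = block_mat P' Q' R' S'"
  have "P = P'" "Q = Q'" "R = R'" "S = S'"
    using arg_cong[OF eq, of "\<lambda>M. M $ Inl _ $ Inl _"] arg_cong[OF eq, of "\<lambda>M. M $ Inl _ $ Inr _"]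
      arg_cong[OF eq, of "\<lambda>M. M $ Inr _ $ Inl _"] arg_cong[OF eq, of "\<lambda>M. M $ Inr _ $ Inr _"]
    by (simp_all add: vec_eq_iff)
  then show "P = P' \<and> Q = Q' \<and> R = R' \<and> S = S'" by blast
qed simp

lemma block_mat_eqI:
  "(\<And>a b. M $ Inl a $ Inl b = P $ a $ b) \<Longrightarrow> (\<And>a b. M $ Inl a $ Inr b = Q $ a $ b) \<Longrightarrow>
   (\<And>a b. M $ Inr a $ Inl b = R $ a $ b) \<Longrightarrow> (\<And>a b. M $ Inr a $ Inr b = S $ a $ b) \<Longrightarrow>
   M = block_mat P Q R S"
  by (simp add: vec_eq_iff block_mat_def split: sum.split)

lemma block_mat_mult:
  "block_mat P Q R S ** block_mat P' Q' R' S' =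
   block_mat (P ** P' + Q ** R') (P ** Q' + Q ** S') (R ** P' + S ** R') (R ** Q' + S ** S')"
  by (rule block_mat_eqI) (simp_all add: matrix_matrix_mult_def sum_Plus)

lemma transpose_block_mat:
  "transpose (block_mat P Q R S) = block_mat (transpose P) (transpose R) (transpose Q) (transpose S)"
  by (rule block_mat_eqI) simp_all

lemma cnj_mat_block_mat:
  "cnj_mat (block_mat P Q R S) = block_mat (cnj_mat P) (cnj_mat Q) (cnj_mat R) (cnj_mat S)"
  by (rule block_mat_eqI) simp_all

lemma block11_block_mat [simp]: "block11 (block_mat P Q R S) = P"
  and block12_block_mat [simp]: "block12 (block_mat P Q R S) = Q"
  by (simp_all add: block11_def block12_def vec_eq_iff)

lemma matrix_mult_0: "A ** 0 = 0" "0 ** A = 0" for A :: "complex^'k^'n"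
  by (simp_all add: vec_eq_iff matrix_matrix_mult_def)

lemma matrix_mult_minus: "A ** (- B) = - (A ** B)" "(- C) ** B = - (C ** B)"
  for A :: "complex^'k^'n"
  by (simp_all add: vec_eq_iff matrix_matrix_mult_def sum_negf)

text \<open>These are the upper two blocks of the preservation of the Hermitian form; the lower two
  are their conjugates up to sign.\<close>

lemma G_star_relations:
  assumes "block_mat P Q (cnj_mat Q) (cnj_mat P) \<in> G_star"
  shows "transpose (cnj_mat P) ** P - transpose Q ** cnj_mat Q = mat 1"
    and "transpose (cnj_mat P) ** Q = transpose Q ** cnj_mat P"
proof -
  let ?M = "block_mat P Q (cnj_mat Q) (cnj_mat P)"
  have "transpose (cnj_mat ?M) ** block_mat (mat 1) 0 0 (- mat 1) ** ?M = block_mat (mat 1) 0 0 (- mat 1)"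
    using assms unfolding G_star_def SU_group_def Let_def by blast
  then show "transpose (cnj_mat P) ** P - transpose Q ** cnj_mat Q = mat 1"
    and "transpose (cnj_mat P) ** Q = transpose Q ** cnj_mat P"
    unfolding transpose_block_mat cnj_mat_block_mat block_mat_mult block_mat_eq_iff
    by (simp_all add: matrix_mult_0 matrix_mult_minus)
qed

section \<open>One group element acting at one point\<close>

locale sj_action = disk_point W for W :: "complex^'n^'n" +
  fixes P Q :: "complex^'n^'n" and \<xi> \<eta> :: "complex^'n^'m"
  assumes PP: "transpose (cnj_mat P) ** P - transpose Q ** cnj_mat Q = mat 1"
    and PQ: "transpose (cnj_mat P) ** Q = transpose Q ** cnj_mat P"
begin

definition Pc where "Pc = cnj_mat P"
definition Qc where "Qc = cnj_mat Q"
definition M where "M = Qc ** W + Pc"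
definition N where "N = matrix_inv M"
definition L where "L = P ** W + Q"
definition W' where "W' = L ** N"
definition \<eta>' where "\<eta>' = (\<eta> + \<xi> ** W + cnj_mat \<xi>) ** N"

lemma transpose_Pc_P: "transpose Pc ** P = mat 1 + transpose Q ** Qc"
  using PP by (simp add: Pc_def Qc_def diff_eq_eq)

lemma transpose_Pc_Q: "transpose Pc ** Q = transpose Q ** Pc"
  using PQ by (simp add: Pc_def)

lemma transpose_Qc_Q: "transpose Qc ** Q = transpose P ** Pc - mat 1"
proof -
  have "cnj_mat (transpose Pc ** P) = cnj_mat (mat 1 + transpose Q ** Qc)" by (simp only: transpose_Pc_P)
  then show ?thesis
    by (simp add: cnj_mat_mult cnj_mat_add cnj_mat_transpose Pc_def Qc_def)
qed

lemma transpose_Qc_P: "transpose Qc ** P = transpose P ** Qc"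
proof -
  have "cnj_mat (transpose Pc ** Q) = cnj_mat (transpose Q ** Pc)" by (simp only: transpose_Pc_Q)
  then show ?thesis
    by (simp add: cnj_mat_mult cnj_mat_add cnj_mat_transpose Pc_def Qc_def)
qed

text \<open>\<open>matrix_mul_assoc\<close> brackets products to the left, so inside a longer
  product a relation can be applied only together with the prefix \<open>X\<close>.\<close>

lemma rel_prefix:
  "X ** transpose Pc ** P = X + X ** transpose Q ** Qc"
  "X ** transpose Pc ** Q = X ** transpose Q ** Pc"
  "X ** transpose Qc ** Q = X ** transpose P ** Pc - X"
  "X ** transpose Qc ** P = X ** transpose P ** Qc"
  by (simp_all add: matrix_mul_assoc[symmetric] transpose_Pc_P transpose_Pc_Q transpose_Qc_Q transpose_Qc_P matrix_add_ldistrib matrix_diff_ldistrib)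

lemma adjoint_M: "transpose (cnj_mat M) = Wc ** transpose Q + transpose P"
  by (simp add: M_def cnj_mat_add cnj_mat_mult transpose_add matrix_transpose_mul Pc_def Qc_def
      Wc_def[symmetric] sym_c)

lemma adjoint_L: "transpose (cnj_mat L) = Wc ** transpose Pc + transpose Qc"
  by (simp add: L_def cnj_mat_add cnj_mat_mult transpose_add matrix_transpose_mul Pc_def Qc_def
      Wc_def[symmetric] sym_c)

text \<open>The block column (\<open>L\<close>, \<open>M\<close>) is the image of (W, I), and the
  group element preserves the Hermitian form of diag(I, -I); both sides are minus that form on the
  respective column.\<close>

lemma adjoint_diff:
  "transpose (cnj_mat M) ** M - transpose (cnj_mat L) ** L = mat 1 - Wc ** W"
  unfolding adjoint_M adjoint_L
  by (simp add: M_def L_def matrix_distribs matrix_mul_assoc rel_prefix transpose_Pc_P transpose_Pc_Q transpose_Qc_Q transpose_Qc_P)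

text \<open>The analogue for the alternating form: it vanishes on the columns of (W, I) because
  \<open>W\<close> is symmetric, hence also on those of (\<open>L\<close>, \<open>M\<close>). This
  makes the image point symmetric.\<close>

lemma transpose_M_L: "transpose M ** L = transpose L ** M"
  by (simp add: M_def L_def transpose_add matrix_transpose_mul sym matrix_distribs matrix_mul_assoc
      rel_prefix transpose_Pc_P transpose_Pc_Q transpose_Qc_Q transpose_Qc_P)

lemma norm_L_less:
  assumes "z \<noteq> 0"
  shows "norm (L *v z) < norm (M *v z)"
proof -
  have self: "herm z ((transpose (cnj_mat X) ** X) *v z) = complex_of_real ((norm (X *v z))\<^sup>2)" for X :: "complex^'n^'n"
    by (simp add: matrix_vector_mul_assoc[symmetric] herm_matrix[of z] cnj_mat_transpose herm_self
        del: transpose_matrix_vector)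
  have "0 < Re (herm z ((mat 1 - Wc ** W) *v z))"
    using pos_def assms unfolding pos_def_hermitian_alt by blast
  also have "\<dots> = (norm (M *v z))\<^sup>2 - (norm (L *v z))\<^sup>2"
    unfolding adjoint_diff[symmetric]
    by (simp only: matrix_vector_mult_diff_rdistrib herm_diff_right self minus_complex.sel Re_complex_of_real)
  finally show ?thesis by (simp add: power2_less_imp_less)
qed

lemma invertible_M: "invertible M"
proof (rule invertible_ker, rule ccontr)
  fix z assume "M *v z = 0" "z \<noteq> 0"
  with norm_L_less[of z] show False by simp
qed

lemma MN: "M ** N = mat 1" "N ** M = mat 1"
  by (simp_all add: N_def matrix_inv_left matrix_inv_right invertible_M)

lemma MN_prefix: "X ** M ** N = X" "X ** N ** M = X"
  by (simp_all add: matrix_mul_assoc[symmetric] MN)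

lemma transpose_NM: "transpose N ** transpose M = mat 1" "transpose M ** transpose N = mat 1"
  by (simp_all add: matrix_transpose_mul[symmetric] MN)

lemma sym': "transpose W' = W'"
proof -
  have "transpose W' = transpose N ** (transpose L ** M) ** N"
    by (simp add: W'_def matrix_transpose_mul matrix_mul_assoc MN_prefix)
  also have "\<dots> = W'"
    by (simp add: transpose_M_L[symmetric] W'_def matrix_mul_assoc transpose_NM)
  finally show ?thesis .
qed

lemma W'_in_disk: "W' \<in> unit_disk"
  unfolding unit_disk_iff
proof (intro conjI allI impI sym')
  fix z :: "complex^'n" assume z: "z \<noteq> 0"
  have Mz: "M *v (N *v z) = z" by (simp add: matrix_vector_mul_assoc MN)
  then have "N *v z \<noteq> 0" using z by auto
  from norm_L_less[OF this] show "norm (W' *v z) < norm z"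
    by (simp add: Mz) (simp add: W'_def matrix_vector_mul_assoc)
qed

sublocale D': disk_point W'
  by unfold_locales (rule W'_in_disk)

text \<open>As \<open>W'\<close> is symmetric, \<open>D'.Wc\<close> is its adjoint, and
  \<open>adjoint_diff\<close> writes \<open>mat 1 - D'.Wc ** W'\<close> as the congruence of
  \<open>mat 1 - Wc ** W\<close> by \<open>N\<close>. Inverting puts \<open>M\<close> in place of
  \<open>N\<close>.\<close>

lemma S'_eq: "D'.S = M ** S ** transpose (cnj_mat M)"
  unfolding D'.S_def
proof (rule matrix_inv_unique)
  have "D'.Wc = transpose (cnj_mat N) ** transpose (cnj_mat L)"
    using D'.sym_c unfolding D'.Wc_def by (simp add: W'_def cnj_mat_mult matrix_transpose_mul)
  moreover have NM: "transpose (cnj_mat N) ** transpose (cnj_mat M) = mat 1"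
    by (simp add: matrix_transpose_mul[symmetric] cnj_mat_mult[symmetric] MN)
  ultimately have "mat 1 - D'.Wc ** W' =
    transpose (cnj_mat N) ** (transpose (cnj_mat M) ** M - transpose (cnj_mat L) ** L) ** N"
    by (simp add: W'_def matrix_distribs matrix_mul_assoc MN_prefix MN)
  then have "(mat 1 - D'.Wc ** W') ** (M ** S ** transpose (cnj_mat M)) =
    transpose (cnj_mat N) ** ((mat 1 - Wc ** W) ** S) ** transpose (cnj_mat M)"
    by (simp only: adjoint_diff matrix_mul_assoc MN_prefix)
  then show "(mat 1 - D'.Wc ** W') ** (M ** S ** transpose (cnj_mat M)) = mat 1"
    by (simp add: S_mult NM)
qed

lemma R'_eq: "D'.R = cnj_mat M ** R ** transpose M"
  unfolding D'.cnj_S[symmetric] S'_eq by (simp add: cnj_mat_mult cnj_S cnj_mat_transpose)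

definition act_deriv :: "(complex^'n^'n) \<times> (complex^'n^'m) \<Rightarrow> (complex^'n^'n) \<times> (complex^'n^'m)" where
  "act_deriv u = (transpose N ** fst u ** N,
     (snd u + \<xi> ** fst u) ** N - \<eta>' ** Qc ** fst u ** N)"

text \<open>The quotient rule for \<open>L ** N\<close> produces the left factor
  \<open>P - W' ** Qc\<close>. That it equals \<open>transpose N\<close> turns the derivative in W
  into a congruence, which preserves symmetric matrices.\<close>

lemma P_minus: "P - W' ** Qc = transpose N"
proof -
  have "transpose M ** P - transpose L ** Qc = mat 1"
    by (simp add: M_def L_def transpose_add matrix_transpose_mul sym matrix_distribs matrix_mul_assoc
      rel_prefix transpose_Pc_P transpose_Pc_Q transpose_Qc_Q transpose_Qc_P)
  then have "transpose N ** (transpose M ** P - transpose L ** Qc) = transpose N" by simp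
  then have "P - transpose W' ** Qc = transpose N"
    by (simp add: matrix_distribs matrix_mul_assoc transpose_NM W'_def matrix_transpose_mul)
  then show ?thesis by (simp add: sym')
qed

lemma act_has_derivative:
  "((\<lambda>(V, e). ((P ** V + Q) ** matrix_inv (Qc ** V + Pc), (e + \<xi> ** V + cnj_mat \<xi>) ** matrix_inv (Qc ** V + Pc)))
    has_derivative act_deriv) (at (W, \<eta>) within D)"
proof -
  have fst: "(fst has_derivative fst) (at (W, \<eta>) within D)"
    and snd: "(snd has_derivative snd) (at (W, \<eta>) within D)"
    by (auto intro: bounded_linear_imp_has_derivative bounded_linear_fst bounded_linear_snd)
  have mult: "((\<lambda>p. X ** fst p) has_derivative (\<lambda>u. X ** fst u)) (at (W, \<eta>) within D)"
    for X :: "complex^'n^'k"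
    by (rule bounded_linear.has_derivative[OF bounded_bilinear.bounded_linear_right[OF bounded_bilinear_matrix_mult] fst])
  have M': "((\<lambda>p. Qc ** fst p + Pc) has_derivative (\<lambda>u. Qc ** fst u)) (at (W, \<eta>) within D)"
    using has_derivative_add[OF mult has_derivative_const] by simp
  have N': "((\<lambda>p. matrix_inv (Qc ** fst p + Pc)) has_derivative (\<lambda>u. - (N ** (Qc ** fst u) ** N))) (at (W, \<eta>) within D)"
    using has_derivative_matrix_inv[OF M'] invertible_M by (simp add: M_def N_def)
  have L': "((\<lambda>p. P ** fst p + Q) has_derivative (\<lambda>u. P ** fst u)) (at (W, \<eta>) within D)"
    using has_derivative_add[OF mult has_derivative_const] by simp
  have e': "((\<lambda>p. snd p + \<xi> ** fst p + cnj_mat \<xi>) has_derivative (\<lambda>u. snd u + \<xi> ** fst u)) (at (W, \<eta>) within D)"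
    using has_derivative_add[OF has_derivative_add[OF snd mult] has_derivative_const] by simp
  have "(\<lambda>u. (L ** - (N ** (Qc ** fst u) ** N) + P ** fst u ** N,
      (\<eta> + \<xi> ** W + cnj_mat \<xi>) ** - (N ** (Qc ** fst u) ** N) + (snd u + \<xi> ** fst u) ** N)) = act_deriv"
    unfolding act_deriv_def
  proof (intro ext prod_eqI, simp_all)
    fix V :: "complex^'n^'n"
    show "L ** - (N ** (Qc ** V) ** N) + P ** V ** N = transpose N ** V ** N"
      unfolding P_minus[symmetric]
      by (simp add: matrix_mult_minus matrix_distribs W'_def matrix_mul_assoc)
    show "(\<eta> + \<xi> ** W + cnj_mat \<xi>) ** - (N ** (Qc ** V) ** N) = - (\<eta>' ** Qc ** V ** N)"
      by (simp add: matrix_mult_minus \<eta>'_def matrix_mul_assoc)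
  qed
  then show ?thesis
    using has_derivative_Pair[OF has_derivative_matrix_mult[OF L' N'] has_derivative_matrix_mult[OF e' N']]
    by (simp add: case_prod_unfold M_def[symmetric] N_def[symmetric] L_def[symmetric])
qed

text \<open>After splitting off d\<eta> N and the common right factor dW N, an identity between
  coefficients of dW remains. Multiplying it by I - W Wc on the right clears \<open>R\<close>, and
  then \<open>e'M\<close> settles it.\<close>

lemma theta_act: "sj_theta (W', \<eta>') (act_deriv u) = sj_theta (W, \<eta>) u ** N"
proof -
  obtain dW d\<eta> where u: "u = (dW, d\<eta>)" by (cases u)
  have e'M: "\<eta>' ** M = \<eta> + \<xi> ** W + cnj_mat \<xi>"
    by (simp add: \<eta>'_def MN_prefix)
  have e'M_prefix: "\<eta>' ** M ** Wc = \<eta> ** Wc + \<xi> ** W ** Wc + cnj_mat \<xi> ** Wc"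
    by (simp add: e'M matrix_distribs)
  have Lc: "D'.Wc ** cnj_mat M = Pc ** Wc + Qc"
  proof -
    have "W' ** M = L" by (simp add: W'_def MN_prefix)
    then show ?thesis
      unfolding D'.Wc_def cnj_mat_mult[symmetric]
      by (simp add: L_def cnj_mat_add cnj_mat_mult Pc_def Qc_def Wc_def)
  qed
  have e'c: "cnj_mat \<eta>' ** cnj_mat M = cnj_mat \<eta> + cnj_mat \<xi> ** Wc + \<xi>"
    by (simp add: cnj_mat_mult[symmetric] e'M cnj_mat_add) (simp add: cnj_mat_mult Wc_def)
  have RdW: "D'.R ** (transpose N ** dW ** N) = cnj_mat M ** R ** dW ** N"
    unfolding R'_eq by (simp add: matrix_mul_assoc[symmetric]) (simp add: matrix_mul_assoc transpose_NM)
  \<comment> \<open>The coefficient of dW, before the factor \<open>N\<close>, in the second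
    component of \<open>act_deriv\<close>.\<close>
  define Z where "Z = \<xi> - \<eta>' ** Qc"
  have "Z ** (mat 1 - W ** Wc) + (\<eta>' ** (Pc ** Wc + Qc) - (cnj_mat \<eta> + cnj_mat \<xi> ** Wc + \<xi>))
      = \<eta>' ** M ** Wc - \<xi> ** W ** Wc - cnj_mat \<xi> ** Wc - cnj_mat \<eta>"
    by (simp add: Z_def M_def matrix_distribs matrix_mul_assoc)
  also have "\<dots> = \<eta> ** Wc - cnj_mat \<eta>"
    by (simp add: e'M_prefix)
  finally have "(Z ** (mat 1 - W ** Wc) + (\<eta>' ** (Pc ** Wc + Qc) - (cnj_mat \<eta> + cnj_mat \<xi> ** Wc + \<xi>))) ** R
      = (\<eta> ** Wc - cnj_mat \<eta>) ** R" by (simp only:)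
  then have Z: "Z + (\<eta>' ** (Pc ** Wc + Qc) - (cnj_mat \<eta> + cnj_mat \<xi> ** Wc + \<xi>)) ** R
      = (\<eta> ** Wc - cnj_mat \<eta>) ** R"
    by (simp add: matrix_add_rdistrib matrix_mul_assoc[symmetric] R_mult)
  have "(\<eta>' ** D'.Wc - cnj_mat \<eta>') ** cnj_mat M = \<eta>' ** (Pc ** Wc + Qc) - (cnj_mat \<eta> + cnj_mat \<xi> ** Wc + \<xi>)"
    by (simp add: matrix_diff_rdistrib e'c matrix_mul_assoc[symmetric] Lc)
  then have "(\<eta>' ** D'.Wc - cnj_mat \<eta>') ** D'.R ** (transpose N ** dW ** N) =
      (\<eta>' ** (Pc ** Wc + Qc) - (cnj_mat \<eta> + cnj_mat \<xi> ** Wc + \<xi>)) ** R ** dW ** N"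
    by (simp only: matrix_mul_assoc[symmetric, of _ "D'.R"] RdW) (simp only: matrix_mul_assoc)
  then have "sj_theta (W', \<eta>') (act_deriv u) = d\<eta> ** N +
      (Z + (\<eta>' ** (Pc ** Wc + Qc) - (cnj_mat \<eta> + cnj_mat \<xi> ** Wc + \<xi>)) ** R) ** dW ** N"
    unfolding u act_deriv_def D'.sj_theta_eq
    by (simp add: Z_def matrix_add_rdistrib matrix_diff_rdistrib)
  then show ?thesis
    unfolding u Z sj_theta_eq by (simp add: matrix_add_rdistrib)
qed

text \<open>The product in the first trace is conjugated by \<open>cnj_mat M\<close>. In the second
  the factors \<open>N\<close> from \<theta> cancel the factors \<open>M\<close> from
  \<open>D'.S\<close>.\<close>

lemma sj_herm_act: "sj_herm A B (W', \<eta>') (act_deriv u) (act_deriv v) = sj_herm A B (W, \<eta>) u v"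
proof -
  have NM: "transpose (cnj_mat M) ** transpose (cnj_mat N) = mat 1"
    by (simp add: matrix_transpose_mul[symmetric] cnj_mat_mult[symmetric] MN)
  have prefix: "X ** transpose M ** transpose N = X" "X ** transpose (cnj_mat M) ** transpose (cnj_mat N) = X"
    for X :: "complex^'n^'k"
    by (simp_all add: matrix_mul_assoc[symmetric] NM transpose_NM)
  have "D'.R ** fst (act_deriv u) ** D'.S ** cnj_mat (fst (act_deriv v)) =
      cnj_mat M ** (R ** fst u ** S ** cnj_mat (fst v) ** cnj_mat N)"
    by (simp add: R'_eq S'_eq act_deriv_def cnj_mat_mult cnj_mat_transpose matrix_mul_assoc prefix MN_prefix)
  then have 1: "trace (D'.R ** fst (act_deriv u) ** D'.S ** cnj_mat (fst (act_deriv v))) =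
      trace (R ** fst u ** S ** cnj_mat (fst v))"
    by (simp add: trace_mul_sym[of "cnj_mat M"])
       (simp add: matrix_mul_assoc[symmetric] cnj_mat_mult[symmetric] MN)
  have 2: "trace (sj_theta (W', \<eta>') (act_deriv u) ** D'.S ** transpose (cnj_mat (sj_theta (W', \<eta>') (act_deriv v)))) =
      trace (sj_theta (W, \<eta>) u ** S ** transpose (cnj_mat (sj_theta (W, \<eta>) v)))"
    by (simp add: theta_act S'_eq cnj_mat_mult matrix_transpose_mul matrix_mul_assoc prefix MN_prefix)
  show ?thesis
    unfolding sj_herm_eq D'.sj_herm_eq 1 2 ..
qed

lemma act_deriv_tangent: "u \<in> sj_tangent \<Longrightarrow> act_deriv u \<in> sj_tangent"
  by (auto simp: sj_tangent_def act_deriv_def matrix_transpose_mul matrix_mul_assoc)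

end

lemma jacobi_act_preserves:
  assumes h: "h \<in> carrier jacobi_group"
  shows "preserves_metric_on (sj_tangent :: ((complex^'n^'n) \<times> (complex^'n^'m)) set) sj_disk
    (\<lambda>p u v. Re (sj_herm A B p u v)) (jacobi_act h)"
  unfolding preserves_metric_on_def
proof
  fix p :: "(complex^'n^'n) \<times> (complex^'n^'m)" assume p: "p \<in> sj_disk"
  obtain W \<eta> where p_eq: "p = (W, \<eta>)" by (cases p)
  obtain P Q \<xi> \<kappa> where h_eq: "h = (block_mat P Q (cnj_mat Q) (cnj_mat P), \<xi>, cnj_mat \<xi>, i_mat \<kappa>)"
    and G: "block_mat P Q (cnj_mat Q) (cnj_mat P) \<in> G_star"
    using h by (auto simp: jacobi_group_def)
  interpret sj_action W P Q \<xi> \<eta>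
    using p G_star_relations[OF G] by unfold_locales (auto simp: p_eq sj_disk_def)
  have act: "jacobi_act h = (\<lambda>(V, e). ((P ** V + Q) ** matrix_inv (Qc ** V + Pc),
      (e + \<xi> ** V + cnj_mat \<xi>) ** matrix_inv (Qc ** V + Pc)))"
    by (simp add: h_eq jacobi_act_def Let_def Pc_def Qc_def)
  have val: "jacobi_act h p = (W', \<eta>')"
    by (simp add: act p_eq W'_def \<eta>'_def L_def N_def M_def)
  show "jacobi_act h p \<in> sj_disk \<and>
    (\<exists>f'. (jacobi_act h has_derivative f') (at p within sj_disk) \<and> f' ` sj_tangent \<subseteq> sj_tangent \<and>
      (\<forall>u\<in>sj_tangent. \<forall>v\<in>sj_tangent. Re (sj_herm A B (jacobi_act h p) (f' u) (f' v)) = Re (sj_herm A B p u v)))"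
  proof (intro conjI exI)
    show "jacobi_act h p \<in> sj_disk" using W'_in_disk by (simp add: val sj_disk_def)
    show "(jacobi_act h has_derivative act_deriv) (at p within sj_disk)"
      unfolding act p_eq by (rule act_has_derivative)
    show "act_deriv ` sj_tangent \<subseteq> sj_tangent" using act_deriv_tangent by blast
    show "\<forall>u\<in>sj_tangent. \<forall>v\<in>sj_tangent. Re (sj_herm A B (jacobi_act h p) (act_deriv u) (act_deriv v)) = Re (sj_herm A B p u v)"
      unfolding val unfolding p_eq sj_herm_act by blast
  qed
qed

section \<open>The case of one-by-one matrices\<close>

lemma (in disk_point) sj_herm_dim_one:
  fixes \<eta> d\<eta> :: "complex^'n^'m" and dW :: "complex^'n^'n" and i :: 'n and k :: 'm
  assumes "CARD('n) = 1" "CARD('m) = 1"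
  defines "w \<equiv> W $ i $ i" and "e \<equiv> \<eta> $ k $ i" and "dw \<equiv> dW $ i $ i" and "de \<equiv> d\<eta> $ k $ i"
    and "r \<equiv> complex_of_real ((cmod (W $ i $ i))\<^sup>2)"
  shows "sj_herm 1 1 (W, \<eta>) (dW, d\<eta>) (dW, d\<eta>) =
    4 * (dw * cnj dw / (1 - r)\<^sup>2
      + (de + (e * cnj w - cnj e) / (1 - r) * dw) * cnj (de + (e * cnj w - cnj e) / (1 - r) * dw) / (1 - r))"
proof -
  have "is_singleton (UNIV :: 'n set)" "is_singleton (UNIV :: 'm set)"
    using assms(1,2) by (simp_all add: is_singleton_altdef)
  then have UNIV: "(UNIV :: 'n set) = {i}" "(UNIV :: 'm set) = {k}"
    by (metis UNIV_I is_singleton_def singletonD)+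
  have r: "r = w * cnj w"
    using complex_norm_square[of w] by (simp add: r_def w_def)
  \<comment> \<open>With a single index the defining equations of \<open>R\<close> and
    \<open>S\<close> become scalar, and both matrices are the reciprocal of 1 - r.\<close>
  have "(R ** (mat 1 - W ** Wc)) $ i $ i = (mat 1 :: complex^'n^'n) $ i $ i"
    "(S ** (mat 1 - Wc ** W)) $ i $ i = (mat 1 :: complex^'n^'n) $ i $ i"
    by (simp_all only: R_mult S_mult)
  then have "R $ i $ i * (1 - r) = 1" "S $ i $ i * (1 - r) = 1"
    by (simp_all add: matrix_matrix_mult_def UNIV mat_def Wc_def r w_def mult.commute)
  moreover from this have "1 - r \<noteq> 0" by auto
  ultimately have RS: "R $ i $ i = 1 / (1 - r)" "S $ i $ i = 1 / (1 - r)"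
    by (simp_all add: nonzero_eq_divide_eq)
  have "sj_theta (W, \<eta>) (dW, d\<eta>) $ k $ i = de + (e * cnj w - cnj e) / (1 - r) * dw"
    unfolding sj_theta_eq by (simp add: matrix_matrix_mult_def UNIV RS Wc_def e_def w_def dw_def de_def)
  then show ?thesis
    unfolding sj_herm_eq
    by (simp add: trace_def matrix_matrix_mult_def UNIV RS dw_def power2_eq_square)
qed

theorem theorem1p1:
  fixes A B :: real
  assumes "A > 0" and "B > 0"
  shows
    "(\<exists>g. riemannian_metric_on
            (sj_tangent :: ((complex^'n::finite^'n) \<times> (complex^'n^'m::finite)) set) sj_disk g \<and>
          (\<forall>p\<in>sj_disk. \<forall>v\<in>sj_tangent. sj_ds2 A B p v = complex_of_real (g p v v)) \<and>
          (\<forall>h\<in>carrier jacobi_group. preserves_metric_on sj_tangent sj_disk g (jacobi_act h)))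
     \<and>
     (CARD('n) = 1 \<and> CARD('m) = 1 \<longrightarrow>
      (\<forall>(W :: complex^'n^'n) (\<eta> :: complex^'n^'m) dW d\<eta> (i :: 'n) (k :: 'm).
         (W, \<eta>) \<in> sj_disk \<and> (dW, d\<eta>) \<in> sj_tangent \<longrightarrow>
         (let w = W $ i $ i; e = \<eta> $ k $ i; dw = dW $ i $ i; de = d\<eta> $ k $ i;
              r = complex_of_real ((cmod w)\<^sup>2)
          in 1 / 4 * sj_ds2 1 1 (W, \<eta>) (dW, d\<eta>) =
               dw * cnj dw / (1 - r)\<^sup>2
             + 1 / (1 - r) * (de * cnj de)
             + ((1 + r) * complex_of_real ((cmod e)\<^sup>2) - cnj w * e\<^sup>2 - w * (cnj e)\<^sup>2)
                 / (1 - r) ^ 3 * (dw * cnj dw)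
             + (e * cnj w - cnj e) / (1 - r)\<^sup>2 * (dw * cnj de)
             + (cnj e * w - e) / (1 - r)\<^sup>2 * (cnj dw * de))))"
proof (intro conjI impI)
  show "\<exists>g. riemannian_metric_on
            (sj_tangent :: ((complex^'n^'n) \<times> (complex^'n^'m)) set) sj_disk g \<and>
          (\<forall>p\<in>sj_disk. \<forall>v\<in>sj_tangent. sj_ds2 A B p v = complex_of_real (g p v v)) \<and>
          (\<forall>h\<in>carrier jacobi_group. preserves_metric_on sj_tangent sj_disk g (jacobi_act h))"
  proof (intro exI conjI ballI)
    show "riemannian_metric_on (sj_tangent :: ((complex^'n^'n) \<times> (complex^'n^'m)) set) sj_disk
        (\<lambda>p u v. Re (sj_herm A B p u v))"
      by (rule riemannian_metric_sj_herm[OF assms])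
    show "preserves_metric_on (sj_tangent :: ((complex^'n^'n) \<times> (complex^'n^'m)) set) sj_disk
        (\<lambda>p u v. Re (sj_herm A B p u v)) (jacobi_act h)" if "h \<in> carrier jacobi_group" for h
      by (rule jacobi_act_preserves[OF that])
    fix p v :: "(complex^'n^'n) \<times> (complex^'n^'m)"
    assume p: "p \<in> sj_disk" and v: "v \<in> sj_tangent"
    obtain W \<eta> dW d\<eta> where eq: "p = (W, \<eta>)" "v = (dW, d\<eta>)" by (cases p, cases v)
    interpret disk_point W using p by unfold_locales (simp add: eq sj_disk_def)
    have dW: "transpose dW = dW" using v by (simp add: eq sj_tangent_def)
    \<comment> \<open>Hermitian symmetry on the diagonal: taking real parts loses nothing.\<close>
    have "cnj (sj_herm A B p v v) = sj_herm A B p v v"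
      using cnj_sj_herm[of v v A B \<eta>] dW by (simp add: eq)
    then have "sj_herm A B p v v = complex_of_real (Re (sj_herm A B p v v))"
      by (metis Reals_cnj_iff of_real_Re)
    then show "sj_ds2 A B p v = complex_of_real (Re (sj_herm A B p v v))"
      using sj_ds2_eq_sj_herm[OF dW] by (simp add: eq)
  qed
next
  assume card: "CARD('n) = 1 \<and> CARD('m) = 1"
  show "\<forall>(W :: complex^'n^'n) (\<eta> :: complex^'n^'m) dW d\<eta> (i :: 'n) (k :: 'm).
         (W, \<eta>) \<in> sj_disk \<and> (dW, d\<eta>) \<in> sj_tangent \<longrightarrow>
         (let w = W $ i $ i; e = \<eta> $ k $ i; dw = dW $ i $ i; de = d\<eta> $ k $ i;
              r = complex_of_real ((cmod w)\<^sup>2)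
          in 1 / 4 * sj_ds2 1 1 (W, \<eta>) (dW, d\<eta>) =
               dw * cnj dw / (1 - r)\<^sup>2
             + 1 / (1 - r) * (de * cnj de)
             + ((1 + r) * complex_of_real ((cmod e)\<^sup>2) - cnj w * e\<^sup>2 - w * (cnj e)\<^sup>2)
                 / (1 - r) ^ 3 * (dw * cnj dw)
             + (e * cnj w - cnj e) / (1 - r)\<^sup>2 * (dw * cnj de)
             + (cnj e * w - e) / (1 - r)\<^sup>2 * (cnj dw * de))"
  proof (intro allI impI, elim conjE)
    fix W :: "complex^'n^'n" and \<eta> :: "complex^'n^'m"
      and dW :: "complex^'n^'n" and d\<eta> :: "complex^'n^'m" and i :: 'n and k :: 'm
    assume p: "(W, \<eta>) \<in> sj_disk" and v: "(dW, d\<eta>) \<in> sj_tangent"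
    interpret disk_point W using p by unfold_locales (simp add: sj_disk_def)
    have dW: "transpose dW = dW" using v by (simp add: sj_tangent_def)
    define w e dw de where defs: "w = W $ i $ i" "e = \<eta> $ k $ i" "dw = dW $ i $ i" "de = d\<eta> $ k $ i"
    define r where "r = complex_of_real ((cmod w)\<^sup>2)"
    \<comment> \<open>With \<open>c\<close> for the reciprocal the claim becomes a polynomial
      identity in which only \<open>cnj c = c\<close> is needed about \<open>c\<close>.\<close>
    define c where "c = inverse (1 - r)"
    have r: "r = w * cnj w" using complex_norm_square[of w] by (simp add: r_def)
    have rr: "cnj r = r" by (simp add: r_def)
    have e: "complex_of_real ((cmod e)\<^sup>2) = e * cnj e" using complex_norm_square[of e] by simp
    have "1 / 4 * sj_ds2 1 1 (W, \<eta>) (dW, d\<eta>) = dw * cnj dw * c\<^sup>2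
      + (de + (e * cnj w - cnj e) * c * dw) * cnj (de + (e * cnj w - cnj e) * c * dw) * c"
      unfolding sj_ds2_eq_sj_herm[OF dW] sj_herm_dim_one[OF card[THEN conjunct1] card[THEN conjunct2], of \<eta> dW d\<eta> i k]
        defs[symmetric] r_def[symmetric] c_def divide_inverse power_inverse
      by simp
    \<comment> \<open>The coefficient of \<open>c ^ 3\<close> is the squared modulus of
      \<open>e * cnj w - cnj e\<close>, multiplied out.\<close>
    also have "\<dots> = dw * cnj dw * c\<^sup>2 + c * (de * cnj de)
      + ((1 + r) * (e * cnj e) - cnj w * e\<^sup>2 - w * (cnj e)\<^sup>2) * c ^ 3 * (dw * cnj dw)
      + (e * cnj w - cnj e) * c\<^sup>2 * (dw * cnj de) + (cnj e * w - e) * c\<^sup>2 * (cnj dw * de)"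
    proof -
      have "cnj c = c" by (simp add: c_def rr)
      then show ?thesis by (simp add: r power2_eq_square power3_eq_cube algebra_simps)
    qed
    finally show "let w = W $ i $ i; e = \<eta> $ k $ i; dw = dW $ i $ i; de = d\<eta> $ k $ i;
              r = complex_of_real ((cmod w)\<^sup>2)
          in 1 / 4 * sj_ds2 1 1 (W, \<eta>) (dW, d\<eta>) =
               dw * cnj dw / (1 - r)\<^sup>2
             + 1 / (1 - r) * (de * cnj de)
             + ((1 + r) * complex_of_real ((cmod e)\<^sup>2) - cnj w * e\<^sup>2 - w * (cnj e)\<^sup>2)
                 / (1 - r) ^ 3 * (dw * cnj dw)
             + (e * cnj w - cnj e) / (1 - r)\<^sup>2 * (dw * cnj de)
             + (cnj e * w - e) / (1 - r)\<^sup>2 * (cnj dw * de)"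
      unfolding Let_def defs[symmetric] r_def[symmetric] e c_def divide_inverse power_inverse mult_1_left .
  qed
qed

end
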